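(* Assume that $\mathbb{E}[\log^2\xi]<\infty$ and that $\mathbb{E}[\lambda_p(\eta)]<\infty$ for every $p\in\mathcal{P}$. Suppose further that $$\mathbb{P}\{\xi\text{ is divisible by }p\}=\mathbb{P}\{\lambda_p(\xi)>0\}>0\quad\text{for every } p\in\mathcal{P}.$$ Then, as $t\to\infty$, $$\left(\left(\frac{\max_{1\le k\le\lfloor tu\rfloor}T_k(p)-\mathbb{E}[\lambda_p(\xi)]\,tu}{t^{1/2}}\right)_{u\ge0}\right)_{p\in\mathcal{P}}\longrightarrow\left((W_p(u))_{u\ge0}\right)_{p\in\mathcal{P}}$$ in the sense of weak convergence of finite-dimensional distributions (that is, joint convergence in distribution for any finite collection of pairs $(u,p)\in[0,\infty)\times\mathcal{P}$). Here the limit is such that, for all $n\in\mathbb{N}$ and all primes $p_1<p_2<\cdots<p_n$, $(W_{p_1}(u),\ldots,W_{p_n}(u))_{u\ge0}$ is an $n$-dimensional centered Wiener process with covariance matrix $C=\|C_{i,j}\|_{1\le i,j\le n}$ given by $C_{i,j}=C_{j,i}=\mathrm{Cov}(\lambda_{p_i}(\xi),\lambda_{p_j}(\xi))$.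
   Context: $\mathbb{N}=\{1,2,\ldots\}$. $(\xi_1,\eta_1),(\xi_2,\eta_2),\ldots$ are independent copies of an $\mathbb{N}^2$-valued random vector $(\xi,\eta)$ with arbitrarily dependent components. $\mathcal{P}$ is the set of prime numbers, and for $n\in\mathbb{N}$, $p\in\mathcal{P}$, $\lambda_p(n)$ is the multiplicity of $p$ in the prime decomposition of $n$, so $n=\prod_{p\in\mathcal{P}}p^{\lambda_p(n)}$. Put $\Pi_0=1$, $\Pi_k=\xi_1\cdots\xi_k$, and $\Theta_k=\Pi_{k-1}\cdot\eta_k$ for $k\in\mathbb{N}$. For $p\in\mathcal{P}$ and $k\in\mathbb{N}$, $$T_k(p):=\lambda_p(\Theta_k)=\sum_{j=1}^{k-1}\lambda_p(\xi_j)+\lambda_p(\eta_k).$$ Convention: a maximum over the empty set (when $\lfloor tu\rfloor=0$) is $0$. An $n$-dimensional centered Wiener process with covariance matrix $C$ is a continuous process with stationary independent increments, started at $0$, whose value at time $u$ is Gaussian with mean $0$ and covariance $uC$ ($C$ may be degenerate). *)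

theory Defs
  imports "HOL-Probability.Probability" "HOL-Computational_Algebra.Primes"
begin

definition Pi_prod :: "(nat \<Rightarrow> 'a \<Rightarrow> nat) \<Rightarrow> nat \<Rightarrow> 'a \<Rightarrow> nat" where
  "Pi_prod \<xi>s k \<omega> = (\<Prod>j=1..k. \<xi>s j \<omega>)"

text \<open>Only used for \<open>k \<ge> 1\<close>.\<close>

definition Theta_prod ::
  "(nat \<Rightarrow> 'a \<Rightarrow> nat) \<Rightarrow> (nat \<Rightarrow> 'a \<Rightarrow> nat) \<Rightarrow> nat \<Rightarrow> 'a \<Rightarrow> nat" where
  "Theta_prod \<xi>s \<eta>s k \<omega> = Pi_prod \<xi>s (k - 1) \<omega> * \<eta>s k \<omega>"

definition T_mult ::
  "(nat \<Rightarrow> 'a \<Rightarrow> nat) \<Rightarrow> (nat \<Rightarrow> 'a \<Rightarrow> nat) \<Rightarrow> nat \<Rightarrow> nat \<Rightarrow> 'a \<Rightarrow> nat" where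
  "T_mult \<xi>s \<eta>s p k \<omega> = multiplicity p (Theta_prod \<xi>s \<eta>s k \<omega>)"

definition max_T ::
  "(nat \<Rightarrow> 'a \<Rightarrow> nat) \<Rightarrow> (nat \<Rightarrow> 'a \<Rightarrow> nat) \<Rightarrow> nat \<Rightarrow> nat \<Rightarrow> 'a \<Rightarrow> nat" where
  "max_T \<xi>s \<eta>s p m \<omega> =
     (if m = 0 then 0 else Max ((\<lambda>k. T_mult \<xi>s \<eta>s p k \<omega>) ` {1..m}))"

definition covariance :: "'a measure \<Rightarrow> ('a \<Rightarrow> real) \<Rightarrow> ('a \<Rightarrow> real) \<Rightarrow> real" where
  "covariance M X Y =
     (\<integral>\<omega>. (X \<omega> - (\<integral>\<omega>'. X \<omega>' \<partial>M)) * (Y \<omega> - (\<integral>\<omega>'. Y \<omega>' \<partial>M)) \<partial>M)"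

text \<open>The one-dimensional normal law with mean \<open>m\<close> and variance \<open>v \<ge> 0\<close>; the degenerate
  case \<open>v = 0\<close> is the point mass at \<open>m\<close>.\<close>

definition normal_law :: "real \<Rightarrow> real \<Rightarrow> real measure" where
  "normal_law m v =
     (if v = 0 then return borel m else density lborel (normal_density m (sqrt v)))"

text \<open>A possibly degenerate Gaussian random vector: every linear combination of the
  coordinates is normal, with the mean and variance prescribed by \<open>m\<close> and \<open>C\<close>.\<close>

definition gaussian_vector ::
  "'a measure \<Rightarrow> 'i set \<Rightarrow> ('i \<Rightarrow> real) \<Rightarrow> ('i \<Rightarrow> 'i \<Rightarrow> real) \<Rightarrow> ('i \<Rightarrow> 'a \<Rightarrow> real) \<Rightarrow> bool" where
  "gaussian_vector M I m C X \<longleftrightarrow>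
     finite I \<and> (\<forall>i\<in>I. X i \<in> borel_measurable M) \<and>
     (\<forall>a :: 'i \<Rightarrow> real.
        distr M borel (\<lambda>\<omega>. \<Sum>i\<in>I. a i * X i \<omega>) =
        normal_law (\<Sum>i\<in>I. a i * m i) (\<Sum>i\<in>I. \<Sum>j\<in>I. a i * a j * C i j))"

text \<open>An \<open>n\<close>-dimensional centered Wiener process with covariance matrix \<open>C\<close>, with coordinates
  indexed by \<open>{1..n}\<close>; \<open>W i u\<close> is the \<open>i\<close>-th coordinate at time \<open>u \<ge> 0\<close>. Continuity of paths
  and the starting value are only required almost surely.\<close>

definition wiener_process ::
  "'a measure \<Rightarrow> nat \<Rightarrow> (nat \<Rightarrow> nat \<Rightarrow> real) \<Rightarrow> (nat \<Rightarrow> real \<Rightarrow> 'a \<Rightarrow> real) \<Rightarrow> bool" where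
  "wiener_process M n C W \<longleftrightarrow>
     prob_space M \<and>
     (\<forall>i\<in>{1..n}. \<forall>u\<ge>0. W i u \<in> borel_measurable M) \<and>
     (AE \<omega> in M. \<forall>i\<in>{1..n}. W i 0 \<omega> = 0 \<and> continuous_on {0..} (\<lambda>u. W i u \<omega>)) \<and>
     (\<forall>m. \<forall>s :: nat \<Rightarrow> real. 0 \<le> s 0 \<and> (\<forall>k<m. s k < s (Suc k)) \<longrightarrow>
        prob_space.indep_vars M (\<lambda>_. PiM {1..n} (\<lambda>_. borel))
          (\<lambda>k \<omega>. \<lambda>i\<in>{1..n}. W i (s (Suc k)) \<omega> - W i (s k) \<omega>) {..<m}) \<and>
     (\<forall>s\<ge>0. \<forall>h\<ge>0.
        distr M (PiM {1..n} (\<lambda>_. borel)) (\<lambda>\<omega>. \<lambda>i\<in>{1..n}. W i (s + h) \<omega> - W i s \<omega>) =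
        distr M (PiM {1..n} (\<lambda>_. borel)) (\<lambda>\<omega>. \<lambda>i\<in>{1..n}. W i h \<omega> - W i 0 \<omega>)) \<and>
     (\<forall>u\<ge>0. gaussian_vector M {1..n} (\<lambda>_. 0) (\<lambda>i j. u * C i j) (\<lambda>i. W i u))"

text \<open>Convergence in distribution, as \<open>t \<rightarrow> \<infinity>\<close>, of the random vectors \<open>(X t j)\<^sub>j\<close> with \<open>j\<close> in a
  finite set \<open>J\<close>, to \<open>(Z j)\<^sub>j\<close>. Vectors are elements of \<open>J \<rightarrow>\<^sub>E UNIV\<close>, on which the
  topology of the function type is that of \<open>\<real>\<^sup>J\<close>.\<close>

definition conv_in_distr ::
  "'i set \<Rightarrow> 'a measure \<Rightarrow> (real \<Rightarrow> 'i \<Rightarrow> 'a \<Rightarrow> real) \<Rightarrow> 'b measure \<Rightarrow> ('i \<Rightarrow> 'b \<Rightarrow> real) \<Rightarrow> bool" where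
  "conv_in_distr J M X N Z \<longleftrightarrow>
     (\<forall>f :: ('i \<Rightarrow> real) \<Rightarrow> real.
        continuous_on (J \<rightarrow>\<^sub>E UNIV) f \<and> bounded (f ` (J \<rightarrow>\<^sub>E UNIV)) \<longrightarrow>
        ((\<lambda>t. \<integral>\<omega>. f (\<lambda>j\<in>J. X t j \<omega>) \<partial>M) \<longlongrightarrow> (\<integral>\<omega>. f (\<lambda>j\<in>J. Z j \<omega>) \<partial>N)) at_top)"

definition conv_fdd ::
  "'i set \<Rightarrow> 'a measure \<Rightarrow> (real \<Rightarrow> 'i \<Rightarrow> 'a \<Rightarrow> real) \<Rightarrow> 'b measure \<Rightarrow> ('i \<Rightarrow> 'b \<Rightarrow> real) \<Rightarrow> bool" where
  "conv_fdd I M X N Z \<longleftrightarrow> (\<forall>J. finite J \<and> J \<subseteq> I \<longrightarrow> conv_in_distr J M X N Z)"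

end

theory Submission
  imports Defs
begin

text \<open>
Fix a prime \<open>p\<close>. The partial sums \<open>S\<^sub>m\<close> of \<open>\<lambda>\<^sub>p(\<xi>\<^sub>1), \<lambda>\<^sub>p(\<xi>\<^sub>2), \<dots>\<close> form a random walk with nonnegative
steps and finite variance, because \<open>\<lambda>\<^sub>p(\<xi>) ln 2 \<le> ln \<xi>\<close>. Since the walk never decreases, the
maximum of \<open>T\<^sub>k(p) = S\<^sub>k\<^sub>-\<^sub>1 + \<lambda>\<^sub>p(\<eta>\<^sub>k)\<close> over \<open>k \<le> m\<close> is close to \<open>S\<^sub>m\<close>: it lies at most one step
below it, and it exceeds \<open>S\<^sub>m\<close> by at most the supremum over \<open>k \<le> m\<close> of
\<open>\<lambda>\<^sub>p(\<eta>\<^sub>k) - (S\<^sub>m - S\<^sub>k)\<close>. Read backwards in time this is a walk with negative drift, perturbed by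
the terms \<open>\<lambda>\<^sub>p(\<eta>\<^sub>k)\<close>. A first moment of \<open>\<lambda>\<^sub>p(\<eta>)\<close> is enough to make \<open>P(\<lambda>\<^sub>p(\<eta>) > c j)\<close> summable
in \<open>j\<close>, and divisibility of \<open>\<xi>\<close> by \<open>p\<close> with positive probability makes the event that the
walk gains less than \<open>c j\<close> in \<open>j\<close> steps exponentially unlikely. So the difference
between the maximum and \<open>S\<^sub>m\<close> is tight uniformly in \<open>m\<close> (\<open>max_T_minus_walk_tight\<close>, from
\<open>perturbed_walk_tight\<close>), and it disappears after division by \<open>sqrt t\<close>.

It remains to prove the finite-dimensional central limit theorem for the walks of finitely
many primes. For a linear combination of the values at finitely many times and primes,
summation by parts over a common time grid produces a sum over independent blocks of
increments; the characteristic function is a product of powers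
\<open>\<psi>\<^sub>k(1 / sqrt t) ^ n\<^sub>k(t)\<close> with \<open>n\<^sub>k(t) / t \<longlonglongrightarrow> s\<^sub>k\<^sub>+\<^sub>1 - s\<^sub>k\<close>, and each factor converges to a Gaussian one
(\<open>char_power_tendsto\<close>). The same summation by parts applied to the Wiener process gives the same
product exactly (\<open>wiener_increments_char\<close>).

Characteristic functions of linear combinations determine joint convergence by the Cramer--Wold
device (\<open>cramer_wold\<close>). Given tightness, a bounded continuous function may be compared, on a large
box, with a trigonometric polynomial, and expectations of trigonometric polynomials are
combinations of values of those characteristic functions.
\<close>

section \<open>Trigonometric polynomials and the Cramer--Wold device\<close>

text \<open>Points that differ in one coordinate are separated in the product topology by preimages of
separating sets under that coordinate. For arbitrary index types this makes function spaces
Hausdorff, which the Stone--Weierstrass theorem asks of its underlying type; the index type here,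
pairs of a time and a prime, is uncountable.\<close>

instance "fun" :: (type, t0_space) t0_space
proof
  fix x y :: "'a \<Rightarrow> 'b"
  assume "x \<noteq> y"
  then obtain i where "x i \<noteq> y i" by auto
  from separation_t0[THEN iffD1, OF this] obtain U where "open U" "\<not> (x i \<in> U \<longleftrightarrow> y i \<in> U)"
    by blast
  then show "\<exists>U. open U \<and> \<not> (x \<in> U \<longleftrightarrow> y \<in> U)"
    by (intro exI[of _ "(\<lambda>z. z i) -` U"])
       (auto intro!: open_vimage continuous_on_product_coordinates)
qed

instance "fun" :: (type, t1_space) t1_space
proof
  fix x y :: "'a \<Rightarrow> 'b"
  assume "x \<noteq> y"
  then obtain i where "x i \<noteq> y i" by auto
  from separation_t1[THEN iffD1, OF this] obtain U where "open U" "x i \<in> U" "y i \<notin> U"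
    by blast
  then show "\<exists>U. open U \<and> x \<in> U \<and> y \<notin> U"
    by (intro exI[of _ "(\<lambda>z. z i) -` U"])
       (auto intro!: open_vimage continuous_on_product_coordinates)
qed

instance "fun" :: (type, t2_space) t2_space
proof
  fix x y :: "'a \<Rightarrow> 'b"
  assume "x \<noteq> y"
  then obtain i where i: "x i \<noteq> y i" by auto
  obtain U V where UV: "open U" "open V" "x i \<in> U" "y i \<in> V" "U \<inter> V = {}"
    using hausdorff[OF i] by blast
  have "open ((\<lambda>z::'a \<Rightarrow> 'b. z i) -` U)" "open ((\<lambda>z::'a \<Rightarrow> 'b. z i) -` V)"
    using UV by (auto intro!: open_vimage continuous_on_product_coordinates)
  then show "\<exists>U V. open U \<and> open V \<and> x \<in> U \<and> y \<in> V \<and> U \<inter> V = {}"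
    using UV by (intro exI[of _ "(\<lambda>z. z i) -` U"] exI[of _ "(\<lambda>z. z i) -` V"]) auto
qed

text \<open>Allowing a phase \<open>b\<close> covers sines as well, and makes
the class closed under products by the product-to-sum formula.\<close>

inductive trig_poly :: "'i set \<Rightarrow> (('i \<Rightarrow> real) \<Rightarrow> real) \<Rightarrow> bool" for J where
  cos: "trig_poly J (\<lambda>x. c * cos ((\<Sum>j\<in>J. a j * x j) + b))"
| add: "trig_poly J f \<Longrightarrow> trig_poly J g \<Longrightarrow> trig_poly J (\<lambda>x. f x + g x)"

lemma trig_poly_const: "trig_poly J (\<lambda>_. c)"
  using trig_poly.cos[of J c "\<lambda>_. 0" 0] by simp

lemma trig_poly_sin_coordinate:
  assumes "finite J" "j \<in> J"
  shows "trig_poly J (\<lambda>x. sin (x j / L))"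
proof -
  have "(\<lambda>x. sin (x j / L)) =
      (\<lambda>x. 1 * cos ((\<Sum>i\<in>J. (if i = j then 1 / L else 0) * x i) + (- pi / 2)))"
    using assms
    by (simp add: fun_eq_iff cos_diff if_distrib[of "\<lambda>c. c * _"] if_distrib[of "\<lambda>c. _ * c"]
          if_distribR cong: if_cong)
  then show ?thesis by (simp only: trig_poly.cos)
qed

lemma trig_poly_cos_mult:
  assumes "trig_poly J g"
  shows "trig_poly J (\<lambda>x. (c * cos ((\<Sum>j\<in>J. a j * x j) + b)) * g x)"
  using assms
proof induction
  case (cos c' a' b')
  have "(\<lambda>x. c * cos ((\<Sum>j\<in>J. a j * x j) + b) * (c' * cos ((\<Sum>j\<in>J. a' j * x j) + b'))) =
    (\<lambda>x. (c * c' / 2) * cos ((\<Sum>j\<in>J. (a j - a' j) * x j) + (b - b')) +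
          (c * c' / 2) * cos ((\<Sum>j\<in>J. (a j + a' j) * x j) + (b + b')))"
  proof
    fix x :: "'a \<Rightarrow> real"
    have d: "(\<Sum>j\<in>J. (a j - a' j) * x j) + (b - b') =
        ((\<Sum>j\<in>J. a j * x j) + b) - ((\<Sum>j\<in>J. a' j * x j) + b')"
      by (simp add: algebra_simps sum_subtractf)
    have s: "(\<Sum>j\<in>J. (a j + a' j) * x j) + (b + b') =
        ((\<Sum>j\<in>J. a j * x j) + b) + ((\<Sum>j\<in>J. a' j * x j) + b')"
      by (simp add: algebra_simps sum.distrib)
    show "c * cos ((\<Sum>j\<in>J. a j * x j) + b) * (c' * cos ((\<Sum>j\<in>J. a' j * x j) + b')) =
      (c * c' / 2) * cos ((\<Sum>j\<in>J. (a j - a' j) * x j) + (b - b')) +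
      (c * c' / 2) * cos ((\<Sum>j\<in>J. (a j + a' j) * x j) + (b + b'))"
      unfolding d s cos_add[of "(\<Sum>j\<in>J. a j * x j) + b"] cos_diff[of "(\<Sum>j\<in>J. a j * x j) + b"]
      by (simp add: algebra_simps)
  qed
  then show ?case by (simp only: trig_poly.add trig_poly.cos)
next
  case (add f g)
  have "(\<lambda>x. c * cos ((\<Sum>j\<in>J. a j * x j) + b) * (f x + g x)) =
      (\<lambda>x. c * cos ((\<Sum>j\<in>J. a j * x j) + b) * f x + c * cos ((\<Sum>j\<in>J. a j * x j) + b) * g x)"
    by (simp only: distrib_left)
  then show ?case by (simp only: trig_poly.add add.IH)
qed

lemma trig_poly_mult:
  assumes "trig_poly J f" "trig_poly J g"
  shows "trig_poly J (\<lambda>x. f x * g x)"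
  using assms(1)
proof induction
  case (cos c a b)
  show ?case by (rule trig_poly_cos_mult[OF assms(2)])
next
  case (add f1 f2)
  have "(\<lambda>x. (f1 x + f2 x) * g x) = (\<lambda>x. f1 x * g x + f2 x * g x)"
    by (simp only: distrib_right)
  then show ?case by (simp only: trig_poly.add add.IH)
qed

text \<open>Approximation by trigonometric polynomials on a box is combined with a bound that holds
everywhere; approximation on a compact set alone would say nothing outside. The trick is to write
a point of the box as \<open>x\<^sub>j = K arcsin (s\<^sub>j)\<close>. The function \<open>s \<mapsto> f (K arcsin s)\<close> is
continuous on the whole cube \<open>[-1, 1]\<^sup>J\<close>, so the Stone--Weierstrass theorem approximates it uniformly
by polynomials in \<open>s\<close>, and substituting \<open>s\<^sub>j = sin (x\<^sub>j / K)\<close> turns these into trigonometric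
polynomials that never leave the \<open>e\<close>-neighbourhood of the range of \<open>f\<close>.\<close>

lemma trig_poly_approx:
  fixes f :: "('i \<Rightarrow> real) \<Rightarrow> real"
  assumes J: "finite J" and f: "continuous_on (J \<rightarrow>\<^sub>E UNIV) f"
    and B: "\<And>x. x \<in> J \<rightarrow>\<^sub>E UNIV \<Longrightarrow> \<bar>f x\<bar> \<le> B" and K: "0 < K" and e: "0 < e"
  obtains G where "trig_poly J G"
    "\<And>x. x \<in> J \<rightarrow>\<^sub>E UNIV \<Longrightarrow> (\<And>j. j \<in> J \<Longrightarrow> \<bar>x j\<bar> \<le> K) \<Longrightarrow> \<bar>f x - G x\<bar> < e"
    "\<And>x. \<bar>G x\<bar> \<le> B + e"
proof -
  define S where "S = (J \<rightarrow>\<^sub>E {-1..1::real})"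
  define \<sigma> where "\<sigma> x = (\<lambda>j\<in>J. sin (x j / K))" for x :: "'i \<Rightarrow> real"
  define F where "F s = f (\<lambda>j\<in>J. K * arcsin (s j))" for s
  define R where "R = {g. continuous_on S g \<and> (\<exists>G. trig_poly J G \<and> (\<forall>x. g (\<sigma> x) = G x))}"
  have \<sigma>S: "\<sigma> x \<in> S" for x
    by (auto simp: \<sigma>_def S_def)
  have cont_coord: "continuous_on S (\<lambda>s. s j)" for j
    by (rule continuous_on_subset[OF continuous_on_product_coordinates]) simp
  interpret function_ring_on R S
  proof
    have "compactin (product_topology (\<lambda>_. euclidean) UNIV)
        (PiE UNIV (\<lambda>j. if j \<in> J then {-1..1::real} else {undefined}))"
      by (subst compactin_PiE) auto
    moreover have "PiE UNIV (\<lambda>j. if j \<in> J then {-1..1::real} else {undefined}) = S"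
      by (auto simp: S_def PiE_def Pi_def extensional_def)
    ultimately show "compact S"
      by (simp add: euclidean_product_topology)
    show "continuous_on S g" if "g \<in> R" for g
      using that by (simp add: R_def)
    show "(\<lambda>s. g s + h s) \<in> R" "(\<lambda>s. g s * h s) \<in> R" if "g \<in> R" "h \<in> R" for g h
    proof -
      obtain G H where "trig_poly J G" "\<And>x. g (\<sigma> x) = G x" "trig_poly J H" "\<And>x. h (\<sigma> x) = H x"
        using \<open>g \<in> R\<close> \<open>h \<in> R\<close> by (auto simp: R_def)
      moreover have "continuous_on S g" "continuous_on S h"
        using that by (auto simp: R_def)
      ultimately have "continuous_on S (\<lambda>s. g s + h s)" "continuous_on S (\<lambda>s. g s * h s)"
        "trig_poly J (\<lambda>x. G x + H x)" "\<forall>x. g (\<sigma> x) + h (\<sigma> x) = G x + H x"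
        "trig_poly J (\<lambda>x. G x * H x)" "\<forall>x. g (\<sigma> x) * h (\<sigma> x) = G x * H x"
        by (simp_all add: continuous_on_add continuous_on_mult trig_poly.add trig_poly_mult)
      then show "(\<lambda>s. g s + h s) \<in> R" "(\<lambda>s. g s * h s) \<in> R"
        unfolding R_def by blast+
    qed
    show "(\<lambda>_. c) \<in> R" for c
      unfolding R_def by (intro CollectI conjI exI[of _ "\<lambda>_. c"] trig_poly_const) auto
    show "\<exists>g\<in>R. g s \<noteq> g s'" if "s \<in> S" "s' \<in> S" "s \<noteq> s'" for s s'
    proof -
      obtain j where j: "j \<in> J" "s j \<noteq> s' j"
        using PiE_ext[of s J _ s'] \<open>s \<in> S\<close> \<open>s' \<in> S\<close> \<open>s \<noteq> s'\<close> unfolding S_def by blast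
      have "(\<lambda>s. s j) \<in> R"
        unfolding R_def
      proof (intro CollectI conjI cont_coord exI allI)
        show "trig_poly J (\<lambda>x. sin (x j / K))" by (rule trig_poly_sin_coordinate[OF J j(1)])
        show "\<sigma> x j = sin (x j / K)" for x using j(1) by (simp add: \<sigma>_def)
      qed
      then show ?thesis by (rule bexI[where x = "\<lambda>s. s j", rotated]) (rule j(2))
    qed
  qed
  have "continuous_on S F"
    unfolding F_def
  proof (rule continuous_on_compose2[OF f])
    show "continuous_on S (\<lambda>s. \<lambda>j\<in>J. K * arcsin (s j))"
    proof (rule continuous_on_coordinatewise_then_product)
      fix j
      show "continuous_on S (\<lambda>s. (\<lambda>j\<in>J. K * arcsin (s j)) j)"
      proof (cases "j \<in> J")
        case True
        then have "-1 \<le> s j \<and> s j \<le> 1" if "s \<in> S" for s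
          using that by (auto simp: S_def PiE_iff)
        then have "continuous_on S (\<lambda>s. K * arcsin (s j))"
          by (intro continuous_intros cont_coord) auto
        with True show ?thesis by simp
      qed simp
    qed
  qed auto
  from Stone_Weierstrass_basic[OF this e]
  obtain g where g: "g \<in> R" "\<And>s. s \<in> S \<Longrightarrow> \<bar>F s - g s\<bar> < e" by blast
  then obtain G where G: "trig_poly J G" "\<And>x. g (\<sigma> x) = G x"
    by (auto simp: R_def)
  show ?thesis
  proof
    show "trig_poly J G" by fact
  next
    fix x assume x: "x \<in> J \<rightarrow>\<^sub>E (UNIV::real set)" "\<And>j. j \<in> J \<Longrightarrow> \<bar>x j\<bar> \<le> K"
    \<comment> \<open>on the box, \<open>x\<^sub>j / K\<close> lies in \<open>[-1, 1] \<subseteq> [-\<pi>/2, \<pi>/2]\<close>, so \<open>arcsin\<close> undoes \<open>sin\<close>\<close>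
    have "K * arcsin (sin (x j / K)) = x j" if "j \<in> J" for j
    proof -
      have "\<bar>x j / K\<bar> \<le> 1" using x(2)[OF that] K by simp
      then have "- 1 \<le> x j / K" "x j / K \<le> 1" by linarith+
      then have "arcsin (sin (x j / K)) = x j / K"
        using pi_ge_two by (intro arcsin_sin) linarith+
      then show ?thesis using K by simp
    qed
    then have "(\<lambda>j\<in>J. K * arcsin (\<sigma> x j)) = x"
      using x(1) by (auto simp: \<sigma>_def PiE_def extensional_def fun_eq_iff)
    then have "F (\<sigma> x) = f x" by (simp add: F_def)
    then show "\<bar>f x - G x\<bar> < e" using g(2)[OF \<sigma>S, of x] G(2) by simp
  next
    fix x
    have "\<bar>F (\<sigma> x)\<bar> \<le> B" unfolding F_def by (rule B) auto
    then show "\<bar>G x\<bar> \<le> B + e" using g(2)[OF \<sigma>S, of x] G(2)[of x] by linarith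
  qed
qed

lemma trig_poly_measurable:
  assumes "trig_poly J G" "\<And>j. j \<in> J \<Longrightarrow> X j \<in> borel_measurable M"
  shows "(\<lambda>\<omega>. G (\<lambda>j\<in>J. X j \<omega>)) \<in> borel_measurable M"
  using assms(1)
proof induction
  case (cos c a b)
  have "(\<lambda>\<omega>. \<Sum>j\<in>J. a j * (\<lambda>j\<in>J. X j \<omega>) j) = (\<lambda>\<omega>. \<Sum>j\<in>J. a j * X j \<omega>)"
    by (auto intro!: sum.cong)
  moreover have "(\<lambda>\<omega>. \<Sum>j\<in>J. a j * X j \<omega>) \<in> borel_measurable M"
    using assms(2) by measurable
  ultimately show ?case by simp
qed simp

text \<open>A bounded continuous function on \<open>\<real>\<^sup>J\<close> is a pointwise limit of trigonometric polynomials: take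
boxes growing to the whole space and errors shrinking to zero. This gives measurability without
comparing the Borel sets of the function space with a product sigma-algebra.\<close>

lemma measurable_continuous_coordinates:
  fixes f :: "('i \<Rightarrow> real) \<Rightarrow> real"
  assumes J: "finite J" and f: "continuous_on (J \<rightarrow>\<^sub>E UNIV) f" "bounded (f ` (J \<rightarrow>\<^sub>E UNIV))"
    and X: "\<And>j. j \<in> J \<Longrightarrow> X j \<in> borel_measurable M"
  shows "(\<lambda>\<omega>. f (\<lambda>j\<in>J. X j \<omega>)) \<in> borel_measurable M"
proof -
  obtain B where B: "\<And>x. x \<in> J \<rightarrow>\<^sub>E UNIV \<Longrightarrow> \<bar>f x\<bar> \<le> B"
    using f(2) by (auto simp: bounded_iff)
  have "\<exists>G. trig_poly J G \<and> (\<forall>x\<in>J \<rightarrow>\<^sub>E UNIV. (\<forall>j\<in>J. \<bar>x j\<bar> \<le> real (Suc n)) \<longrightarrow> \<bar>f x - G x\<bar> < 1 / real (Suc n))"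
    for n
    by (rule trig_poly_approx[OF J f(1) B, of "real (Suc n)" "1 / real (Suc n)"]) auto
  then obtain G where G: "\<And>n. trig_poly J (G n)"
    "\<And>n x. x \<in> J \<rightarrow>\<^sub>E UNIV \<Longrightarrow> (\<And>j. j \<in> J \<Longrightarrow> \<bar>x j\<bar> \<le> real (Suc n)) \<Longrightarrow> \<bar>f x - G n x\<bar> < 1 / real (Suc n)"
    by metis
  show ?thesis
  proof (rule borel_measurable_LIMSEQ_real)
    show "(\<lambda>\<omega>. G n (\<lambda>j\<in>J. X j \<omega>)) \<in> borel_measurable M" for n
      by (rule trig_poly_measurable[OF G(1) X])
    fix \<omega>
    let ?x = "\<lambda>j\<in>J. X j \<omega>"
    obtain n0 :: nat where n0: "(\<Sum>j\<in>J. \<bar>X j \<omega>\<bar>) \<le> n0"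
      using real_arch_simple by blast
    have "\<bar>?x j\<bar> \<le> real (Suc n)" if "n0 \<le> n" "j \<in> J" for n j
    proof -
      have "\<bar>X j \<omega>\<bar> \<le> (\<Sum>j\<in>J. \<bar>X j \<omega>\<bar>)"
        using J that by (intro member_le_sum) auto
      then show ?thesis using n0 that by simp
    qed
    then have "\<bar>f ?x - G n ?x\<bar> < 1 / real (Suc n)" if "n0 \<le> n" for n
      using that by (intro G(2)) auto
    then have "\<bar>G n ?x - f ?x\<bar> \<le> 1 / real (Suc n)" if "n0 \<le> n" for n
      using that by (subst abs_minus_commute) (rule less_imp_le)
    then have "eventually (\<lambda>n. norm (G n ?x - f ?x) \<le> 1 / real (Suc n)) sequentially"
      by (auto simp: eventually_sequentially)
    then have "(\<lambda>n. G n ?x - f ?x) \<longlonglongrightarrow> 0"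
      by (rule Lim_null_comparison) (rule LIMSEQ_Suc, rule lim_inverse_n')
    then show "(\<lambda>n. G n ?x) \<longlonglongrightarrow> f ?x" by (simp add: LIM_zero_iff)
  qed
qed

text \<open>The form in which every approximation is used: a small error off an event, a bounded one on it.\<close>

lemma (in prob_space) expectation_diff_le:
  fixes u v :: "'a \<Rightarrow> 'b::{banach, second_countable_topology}"
  assumes [measurable]: "u \<in> borel_measurable M" "v \<in> borel_measurable M"
    and A: "A \<in> events" and "0 \<le> e" "0 \<le> C"
    and bu: "\<And>\<omega>. \<omega> \<in> space M \<Longrightarrow> norm (u \<omega>) \<le> B" and bv: "\<And>\<omega>. \<omega> \<in> space M \<Longrightarrow> norm (v \<omega>) \<le> B'"
    and off: "\<And>\<omega>. \<omega> \<in> space M - A \<Longrightarrow> norm (u \<omega> - v \<omega>) \<le> e"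
    and on: "\<And>\<omega>. \<omega> \<in> A \<Longrightarrow> norm (u \<omega> - v \<omega>) \<le> C"
  shows "norm (expectation u - expectation v) \<le> e + C * prob A"
proof -
  have iu: "integrable M u" by (rule integrable_const_bound[where B=B]) (auto simp: bu)
  have iv: "integrable M v" by (rule integrable_const_bound[where B=B']) (auto simp: bv)
  have "norm (expectation u - expectation v) = norm (expectation (\<lambda>\<omega>. u \<omega> - v \<omega>))"
    using iu iv by simp
  also have "\<dots> \<le> expectation (\<lambda>\<omega>. norm (u \<omega> - v \<omega>))"
    by (rule integral_norm_bound)
  also have "\<dots> \<le> expectation (\<lambda>\<omega>. e + C * indicator A \<omega>)"
  proof (rule integral_mono)
    show "integrable M (\<lambda>\<omega>. norm (u \<omega> - v \<omega>))" using iu iv by auto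
    show "integrable M (\<lambda>\<omega>. e + C * indicator A \<omega>)" using A
      by (auto simp: emeasure_eq_measure)
    show "norm (u \<omega> - v \<omega>) \<le> e + C * indicator A \<omega>" if "\<omega> \<in> space M" for \<omega>
      using off[of \<omega>] on[of \<omega>] that \<open>0 \<le> e\<close> by (cases "\<omega> \<in> A") auto
  qed
  also have "\<dots> = e + C * prob A"
    using A by (simp add: prob_space emeasure_eq_measure)
  finally show ?thesis .
qed

text \<open>This identity reduces expectations of trigonometric polynomials to characteristic functions.\<close>

lemma (in prob_space) expectation_cos_eq_char:
  assumes [measurable]: "random_variable borel Y"
  shows "expectation (\<lambda>\<omega>. cos (Y \<omega> + b)) = Re (cis b * char (distr M borel Y) 1)"
proof -
  have i: "integrable M (\<lambda>\<omega>. iexp (Y \<omega>))"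
    by (rule integrable_iexp) auto
  have "Re (cis b * char (distr M borel Y) 1) = Re (CLINT \<omega>|M. cis b * iexp (Y \<omega>))"
    by (simp add: char_def integral_distr)
  also have "\<dots> = expectation (\<lambda>\<omega>. Re (cis b * iexp (Y \<omega>)))"
    using i by (subst integral_Re) auto
  also have "(\<lambda>\<omega>. Re (cis b * iexp (Y \<omega>))) = (\<lambda>\<omega>. cos (Y \<omega> + b))"
    by (simp add: cis_conv_exp[symmetric] cis_mult add.commute)
  finally show ?thesis ..
qed

lemma trig_poly_expectation_tendsto:
  assumes "prob_space M" "prob_space N"
    and X [measurable]: "\<And>t j. j \<in> J \<Longrightarrow> X t j \<in> borel_measurable M"
    and Z [measurable]: "\<And>j. j \<in> J \<Longrightarrow> Z j \<in> borel_measurable N"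
    and conv: "\<And>a. ((\<lambda>t. char (distr M borel (\<lambda>\<omega>. \<Sum>j\<in>J. a j * X t j \<omega>)) 1)
            \<longlongrightarrow> char (distr N borel (\<lambda>\<omega>. \<Sum>j\<in>J. a j * Z j \<omega>)) 1) F"
    and "trig_poly J G"
  shows "((\<lambda>t. \<integral>\<omega>. G (\<lambda>j\<in>J. X t j \<omega>) \<partial>M) \<longlongrightarrow> (\<integral>\<omega>. G (\<lambda>j\<in>J. Z j \<omega>) \<partial>N)) F"
proof -
  interpret M: prob_space M by fact
  interpret N: prob_space N by fact
  \<comment> \<open>integrability is carried along to split the expectation of a sum\<close>
  have "((\<lambda>t. \<integral>\<omega>. G (\<lambda>j\<in>J. X t j \<omega>) \<partial>M) \<longlongrightarrow> (\<integral>\<omega>. G (\<lambda>j\<in>J. Z j \<omega>) \<partial>N)) F \<and>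
      (\<forall>t. integrable M (\<lambda>\<omega>. G (\<lambda>j\<in>J. X t j \<omega>))) \<and> integrable N (\<lambda>\<omega>. G (\<lambda>j\<in>J. Z j \<omega>))"
    using \<open>trig_poly J G\<close>
  proof induction
    case (cos c a b)
    have r: "(\<Sum>j\<in>J. a j * (\<lambda>j\<in>J. f j) j) = (\<Sum>j\<in>J. a j * f j)" for f :: "_ \<Rightarrow> real"
      by (auto intro!: sum.cong)
    have iX: "integrable M (\<lambda>\<omega>. c * cos ((\<Sum>j\<in>J. a j * X t j \<omega>) + b))" for t
      by (rule M.integrable_const_bound[where B="\<bar>c\<bar>"]) (auto simp: abs_mult mult_left_le)
    have iZ: "integrable N (\<lambda>\<omega>. c * cos ((\<Sum>j\<in>J. a j * Z j \<omega>) + b))"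
      by (rule N.integrable_const_bound[where B="\<bar>c\<bar>"]) (auto simp: abs_mult mult_left_le)
    have eqX: "(\<integral>\<omega>. c * cos ((\<Sum>j\<in>J. a j * X t j \<omega>) + b) \<partial>M) =
        c * Re (cis b * char (distr M borel (\<lambda>\<omega>. \<Sum>j\<in>J. a j * X t j \<omega>)) 1)" for t
      by (subst M.expectation_cos_eq_char[symmetric]) auto
    have eqZ: "(\<integral>\<omega>. c * cos ((\<Sum>j\<in>J. a j * Z j \<omega>) + b) \<partial>N) =
        c * Re (cis b * char (distr N borel (\<lambda>\<omega>. \<Sum>j\<in>J. a j * Z j \<omega>)) 1)"
      by (subst N.expectation_cos_eq_char[symmetric]) auto
    show ?case unfolding r eqX eqZ
      by (intro conjI allI iX iZ tendsto_mult tendsto_const tendsto_Re conv[of a])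
  next
    case (add f g)
    then show ?case by (simp add: tendsto_add)
  qed
  then show ?thesis ..
qed

lemma (in prob_space) tight_single:
  assumes [measurable]: "random_variable borel (Y :: 'a \<Rightarrow> real)" and "0 < e"
  obtains K where "prob {\<omega> \<in> space M. \<bar>Y \<omega>\<bar> > K} \<le> e"
proof -
  let ?A = "\<lambda>n::nat. {\<omega> \<in> space M. \<bar>Y \<omega>\<bar> > n}"
  have "(\<lambda>n. prob (?A n)) \<longlonglongrightarrow> prob (\<Inter>n. ?A n)"
    by (rule finite_Lim_measure_decseq) (auto simp: decseq_def)
  moreover have "(\<Inter>n. ?A n) = {}"
  proof -
    have "\<not> (\<forall>n::nat. real n < \<bar>Y \<omega>\<bar>)" for \<omega>
      using real_arch_simple by (meson not_less)
    then show ?thesis by auto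
  qed
  ultimately have "(\<lambda>n. prob (?A n)) \<longlonglongrightarrow> 0" by simp
  then have "eventually (\<lambda>n. prob (?A n) < e) sequentially"
    using \<open>0 < e\<close> by (rule order_tendstoD)
  then obtain n where "prob (?A n) < e" by (auto simp: eventually_sequentially)
  then show ?thesis using that[of "real n"] by simp
qed

lemma (in prob_space) prob_Union_le_card:
  fixes e :: real
  assumes "finite J" "\<And>j. j \<in> J \<Longrightarrow> A j \<in> events" "\<And>j. j \<in> J \<Longrightarrow> prob (A j) \<le> e"
  shows "prob (\<Union>j\<in>J. A j) \<le> card J * e"
proof -
  have "prob (\<Union>j\<in>J. A j) \<le> (\<Sum>j\<in>J. prob (A j))"
    using assms by (intro finite_measure_subadditive_finite) auto
  also have "\<dots> \<le> card J * e"
    using sum_bounded_above[of J "\<lambda>j. prob (A j)" e] assms(3) by simp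
  finally show ?thesis .
qed

text \<open>Outside a large box both vectors have small probability, and there the trigonometric approximation
of \<open>f\<close> is still bounded; inside the box it is uniformly close to \<open>f\<close>. So the expectations of
\<open>f\<close> inherit the convergence of those of the approximation.\<close>

theorem cramer_wold:
  fixes X :: "real \<Rightarrow> 'i \<Rightarrow> 'a \<Rightarrow> real" and Z :: "'i \<Rightarrow> 'b \<Rightarrow> real"
  assumes "prob_space M" "prob_space N" and J: "finite J"
    and X [measurable]: "\<And>t j. j \<in> J \<Longrightarrow> X t j \<in> borel_measurable M"
    and Z [measurable]: "\<And>j. j \<in> J \<Longrightarrow> Z j \<in> borel_measurable N"
    and tight: "\<And>j e. j \<in> J \<Longrightarrow> 0 < e \<Longrightarrow>
        \<exists>K. \<forall>\<^sub>F t in at_top. measure M {\<omega> \<in> space M. \<bar>X t j \<omega>\<bar> > K} \<le> e"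
    and conv: "\<And>a. ((\<lambda>t. char (distr M borel (\<lambda>\<omega>. \<Sum>j\<in>J. a j * X t j \<omega>)) 1)
            \<longlongrightarrow> char (distr N borel (\<lambda>\<omega>. \<Sum>j\<in>J. a j * Z j \<omega>)) 1) at_top"
  shows "conv_in_distr J M X N Z"
  unfolding conv_in_distr_def
proof (intro allI impI)
  interpret M: prob_space M by fact
  interpret N: prob_space N by fact
  fix f :: "('i \<Rightarrow> real) \<Rightarrow> real"
  assume "continuous_on (J \<rightarrow>\<^sub>E UNIV) f \<and> bounded (f ` (J \<rightarrow>\<^sub>E UNIV))"
  then have f: "continuous_on (J \<rightarrow>\<^sub>E UNIV) f" and bf: "bounded (f ` (J \<rightarrow>\<^sub>E UNIV))" by auto
  obtain B where B: "0 < B" "\<And>x. x \<in> J \<rightarrow>\<^sub>E UNIV \<Longrightarrow> \<bar>f x\<bar> \<le> B"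
    using bf unfolding bounded_pos by auto
  note meas = measurable_continuous_coordinates[OF J f bf]
  show "((\<lambda>t. \<integral>\<omega>. f (\<lambda>j\<in>J. X t j \<omega>) \<partial>M) \<longlongrightarrow> (\<integral>\<omega>. f (\<lambda>j\<in>J. Z j \<omega>) \<partial>N)) at_top"
  proof (rule tendstoI)
    fix r :: real assume "0 < r"
    \<comment> \<open>\<open>e\<close> bounds the tail of each coordinate, so that leaving the box costs at most \<open>d\<close> in total; each
      of the two vectors then contributes \<open>2 d\<close>, and the trigonometric polynomial one more \<open>d\<close>\<close>
    define d where "d = min 1 (r / 6)"
    define e where "e = d / ((2 * B + 1) * (card J + 1))"
    have d: "0 < d" "d \<le> 1" "6 * d \<le> r" using \<open>0 < r\<close> by (auto simp: d_def)
    have e: "0 < e" using d B(1) by (auto simp: e_def intro!: divide_pos_pos mult_pos_pos add_pos_nonneg)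
    have eC: "(2 * B + 1) * (card J * e) \<le> d"
    proof -
      have "(2 * B + 1) * (card J * e) = d * (card J / (card J + 1))"
        using B(1) by (simp add: e_def)
      also have "\<dots> \<le> d * 1" using d by (intro mult_left_mono) (auto simp: divide_le_eq_1)
      finally show ?thesis by simp
    qed
    have "\<forall>j\<in>J. \<exists>K. \<forall>\<^sub>F t in at_top. measure M {\<omega> \<in> space M. \<bar>X t j \<omega>\<bar> > K} \<le> e"
      using tight e by blast
    from bchoice[OF this] obtain KX where
      KX: "\<And>j. j \<in> J \<Longrightarrow> \<forall>\<^sub>F t in at_top. measure M {\<omega> \<in> space M. \<bar>X t j \<omega>\<bar> > KX j} \<le> e"
      by auto
    have "\<forall>j\<in>J. \<exists>K. measure N {\<omega> \<in> space N. \<bar>Z j \<omega>\<bar> > K} \<le> e"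
      using N.tight_single[OF Z e] by blast
    from bchoice[OF this] obtain KZ where
      KZ: "\<And>j. j \<in> J \<Longrightarrow> measure N {\<omega> \<in> space N. \<bar>Z j \<omega>\<bar> > KZ j} \<le> e"
      by auto
    define K where "K = 1 + (\<Sum>j\<in>J. \<bar>KX j\<bar> + \<bar>KZ j\<bar>)"
    have K: "0 < K" "KX j \<le> K" "KZ j \<le> K" if "j \<in> J" for j
    proof -
      have "\<bar>KX j\<bar> + \<bar>KZ j\<bar> \<le> (\<Sum>j\<in>J. \<bar>KX j\<bar> + \<bar>KZ j\<bar>)"
        using J that by (intro member_le_sum) auto
      then show "0 < K" "KX j \<le> K" "KZ j \<le> K" by (auto simp: K_def)
    qed
    have "0 < K" unfolding K_def by (intro add_pos_nonneg sum_nonneg) auto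
    obtain G where G: "trig_poly J G"
      "\<And>x. x \<in> J \<rightarrow>\<^sub>E UNIV \<Longrightarrow> (\<And>j. j \<in> J \<Longrightarrow> \<bar>x j\<bar> \<le> K) \<Longrightarrow> \<bar>f x - G x\<bar> < d"
      "\<And>x. \<bar>G x\<bar> \<le> B + d"
      using trig_poly_approx[OF J f B(2) \<open>0 < K\<close> d(1)] by blast
    have close: "\<bar>(\<integral>\<omega>. f (\<lambda>j\<in>J. Y j \<omega>) \<partial>P) - (\<integral>\<omega>. G (\<lambda>j\<in>J. Y j \<omega>) \<partial>P)\<bar> \<le> 2 * d"
      if "prob_space P" and Y [measurable]: "\<And>j. j \<in> J \<Longrightarrow> Y j \<in> borel_measurable P"
        and tail: "\<And>j. j \<in> J \<Longrightarrow> measure P {\<omega> \<in> space P. \<bar>Y j \<omega>\<bar> > K} \<le> e"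
      for P :: "'c measure" and Y
    proof -
      interpret P: prob_space P by fact
      let ?A = "\<Union>j\<in>J. {\<omega> \<in> space P. \<bar>Y j \<omega>\<bar> > K}"
      have "norm ((\<integral>\<omega>. f (\<lambda>j\<in>J. Y j \<omega>) \<partial>P) - (\<integral>\<omega>. G (\<lambda>j\<in>J. Y j \<omega>) \<partial>P)) \<le> d + (2 * B + 1) * measure P ?A"
      proof (rule P.expectation_diff_le)
        show "(\<lambda>\<omega>. f (\<lambda>j\<in>J. Y j \<omega>)) \<in> borel_measurable P" by (rule meas[OF Y])
        show "(\<lambda>\<omega>. G (\<lambda>j\<in>J. Y j \<omega>)) \<in> borel_measurable P" by (rule trig_poly_measurable[OF G(1) Y])
        show "?A \<in> P.events" using J by (intro sets.finite_UN) auto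
        show "norm (f (\<lambda>j\<in>J. Y j \<omega>)) \<le> B" for \<omega> using B(2)[of "\<lambda>j\<in>J. Y j \<omega>"] by simp
        show "norm (G (\<lambda>j\<in>J. Y j \<omega>)) \<le> B + d" for \<omega> using G(3) by simp
        show "norm (f (\<lambda>j\<in>J. Y j \<omega>) - G (\<lambda>j\<in>J. Y j \<omega>)) \<le> d" if "\<omega> \<in> space P - ?A" for \<omega>
          unfolding real_norm_def using that by (intro less_imp_le[OF G(2)]) (auto simp: not_less)
        show "norm (f (\<lambda>j\<in>J. Y j \<omega>) - G (\<lambda>j\<in>J. Y j \<omega>)) \<le> 2 * B + 1" for \<omega>
          using B(2)[of "\<lambda>j\<in>J. Y j \<omega>"] G(3)[of "\<lambda>j\<in>J. Y j \<omega>"] d by simp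
      qed (use d B in auto)
      also have "(2 * B + 1) * measure P ?A \<le> (2 * B + 1) * (card J * e)"
        using B(1) by (intro mult_left_mono P.prob_Union_le_card[OF J _ tail]) auto
      finally show ?thesis using eC by simp
    qed
    have closeZ: "\<bar>(\<integral>\<omega>. f (\<lambda>j\<in>J. Z j \<omega>) \<partial>N) - (\<integral>\<omega>. G (\<lambda>j\<in>J. Z j \<omega>) \<partial>N)\<bar> \<le> 2 * d"
    proof (rule close[OF \<open>prob_space N\<close> Z])
      fix j assume j: "j \<in> J"
      have "measure N {\<omega> \<in> space N. \<bar>Z j \<omega>\<bar> > K} \<le> measure N {\<omega> \<in> space N. \<bar>Z j \<omega>\<bar> > KZ j}"
        using K(3)[OF j] j by (intro N.finite_measure_mono) auto
      then show "measure N {\<omega> \<in> space N. \<bar>Z j \<omega>\<bar> > K} \<le> e" using KZ[OF j] by simp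
    qed
    have "\<forall>\<^sub>F t in at_top. \<forall>j\<in>J. measure M {\<omega> \<in> space M. \<bar>X t j \<omega>\<bar> > KX j} \<le> e"
      using KX J by (simp add: eventually_ball_finite)
    moreover have "\<forall>\<^sub>F t in at_top. dist (\<integral>\<omega>. G (\<lambda>j\<in>J. X t j \<omega>) \<partial>M) (\<integral>\<omega>. G (\<lambda>j\<in>J. Z j \<omega>) \<partial>N) < d"
      using trig_poly_expectation_tendsto[OF \<open>prob_space M\<close> \<open>prob_space N\<close> X Z conv G(1)] d(1)
      by (rule tendstoD)
    ultimately show "\<forall>\<^sub>F t in at_top. dist (\<integral>\<omega>. f (\<lambda>j\<in>J. X t j \<omega>) \<partial>M) (\<integral>\<omega>. f (\<lambda>j\<in>J. Z j \<omega>) \<partial>N) < r"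
    proof eventually_elim
      case (elim t)
      have "\<bar>(\<integral>\<omega>. f (\<lambda>j\<in>J. X t j \<omega>) \<partial>M) - (\<integral>\<omega>. G (\<lambda>j\<in>J. X t j \<omega>) \<partial>M)\<bar> \<le> 2 * d"
      proof (rule close[OF \<open>prob_space M\<close> X])
        fix j assume j: "j \<in> J"
        have "measure M {\<omega> \<in> space M. \<bar>X t j \<omega>\<bar> > K} \<le> measure M {\<omega> \<in> space M. \<bar>X t j \<omega>\<bar> > KX j}"
          using K(2)[OF j] j by (intro M.finite_measure_mono) auto
        then show "measure M {\<omega> \<in> space M. \<bar>X t j \<omega>\<bar> > K} \<le> e" using elim(1) j by force
      qed
      then show ?case using closeZ elim(2) d by (simp add: dist_real_def)
    qed
  qed
qed

lemma (in prob_space) char_diff_le: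
  assumes [measurable]: "random_variable borel U" "random_variable borel V" and "0 \<le> e"
  shows "cmod (char (distr M borel U) 1 - char (distr M borel V) 1)
      \<le> e + 2 * prob {\<omega> \<in> space M. \<bar>U \<omega> - V \<omega>\<bar> > e}"
proof -
  have "norm (expectation (\<lambda>\<omega>. iexp (U \<omega>)) - expectation (\<lambda>\<omega>. iexp (V \<omega>)))
      \<le> e + 2 * prob {\<omega> \<in> space M. \<bar>U \<omega> - V \<omega>\<bar> > e}"
  proof (rule expectation_diff_le)
    have eq: "norm (iexp x - iexp y) = norm (iexp (x - y) - 1)" for x y :: real
    proof -
      have "iexp x = exp (\<i> * y + \<i> * (x - y))" by (simp add: algebra_simps)
      then have "iexp x = iexp y * iexp (x - y)" by (simp only: exp_add)
      then have "iexp x - iexp y = iexp y * (iexp (x - y) - 1)" by (simp only: right_diff_distrib mult_1_right)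
      then show ?thesis by (simp add: norm_mult)
    qed
    have le: "norm (iexp x - iexp y) \<le> \<bar>x - y\<bar>" for x y :: real
      using iexp_approx1[of "x - y" 0] by (simp add: eq)
    show "norm (iexp (U \<omega>) - iexp (V \<omega>)) \<le> e"
      if "\<omega> \<in> space M - {\<omega> \<in> space M. \<bar>U \<omega> - V \<omega>\<bar> > e}" for \<omega>
      using that by (intro order_trans[OF le]) auto
    show "norm (iexp (U \<omega>) - iexp (V \<omega>)) \<le> 2" for \<omega>
      using norm_triangle_ineq4[of "iexp (U \<omega>)" "iexp (V \<omega>)"] by simp
  qed (use \<open>0 \<le> e\<close> in auto)
  then show ?thesis by (simp add: char_def integral_distr)
qed

text \<open>Slutsky's addition to the device: tightness and convergence of characteristic functions only have to
be checked for an approximating family \<open>X'\<close>, because \<open>x \<mapsto> exp (i x)\<close> is bounded and Lipschitz.\<close>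

lemma cramer_wold_slutsky:
  fixes X X' :: "real \<Rightarrow> 'i \<Rightarrow> 'a \<Rightarrow> real" and Z :: "'i \<Rightarrow> 'b \<Rightarrow> real"
  assumes "prob_space M" "prob_space N" and J: "finite J"
    and X [measurable]: "\<And>t j. j \<in> J \<Longrightarrow> X t j \<in> borel_measurable M"
    and X' [measurable]: "\<And>t j. j \<in> J \<Longrightarrow> X' t j \<in> borel_measurable M"
    and Z [measurable]: "\<And>j. j \<in> J \<Longrightarrow> Z j \<in> borel_measurable N"
    and tight: "\<And>j e. j \<in> J \<Longrightarrow> 0 < e \<Longrightarrow>
        \<exists>K. \<forall>\<^sub>F t in at_top. measure M {\<omega> \<in> space M. \<bar>X' t j \<omega>\<bar> > K} \<le> e"
    and close: "\<And>j e. j \<in> J \<Longrightarrow> 0 < e \<Longrightarrow>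
        ((\<lambda>t. measure M {\<omega> \<in> space M. \<bar>X t j \<omega> - X' t j \<omega>\<bar> > e}) \<longlongrightarrow> 0) at_top"
    and conv: "\<And>a. ((\<lambda>t. char (distr M borel (\<lambda>\<omega>. \<Sum>j\<in>J. a j * X' t j \<omega>)) 1)
            \<longlongrightarrow> char (distr N borel (\<lambda>\<omega>. \<Sum>j\<in>J. a j * Z j \<omega>)) 1) at_top"
  shows "conv_in_distr J M X N Z"
proof (rule cramer_wold[OF assms(1,2) J X Z])
  interpret M: prob_space M by fact
  fix j and e :: real assume j: "j \<in> J" and "0 < e"
  then obtain K where K: "\<forall>\<^sub>F t in at_top. measure M {\<omega> \<in> space M. \<bar>X' t j \<omega>\<bar> > K} \<le> e / 2"
    using tight[of j "e / 2"] by auto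
  have "\<forall>\<^sub>F t in at_top. measure M {\<omega> \<in> space M. \<bar>X t j \<omega> - X' t j \<omega>\<bar> > 1} < e / 2"
    using close[OF j, of 1] \<open>0 < e\<close> by (intro order_tendstoD) auto
  with K have "\<forall>\<^sub>F t in at_top. measure M {\<omega> \<in> space M. \<bar>X t j \<omega>\<bar> > K + 1} \<le> e"
  proof eventually_elim
    case (elim t)
    have "measure M {\<omega> \<in> space M. \<bar>X t j \<omega>\<bar> > K + 1} \<le>
        measure M ({\<omega> \<in> space M. \<bar>X' t j \<omega>\<bar> > K} \<union> {\<omega> \<in> space M. \<bar>X t j \<omega> - X' t j \<omega>\<bar> > 1})"
      using j by (intro M.finite_measure_mono) auto
    also have "\<dots> \<le> measure M {\<omega> \<in> space M. \<bar>X' t j \<omega>\<bar> > K} + measure M {\<omega> \<in> space M. \<bar>X t j \<omega> - X' t j \<omega>\<bar> > 1}"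
      using j by (intro measure_Un_le) auto
    finally show ?case using elim by simp
  qed
  then show "\<exists>K. \<forall>\<^sub>F t in at_top. measure M {\<omega> \<in> space M. \<bar>X t j \<omega>\<bar> > K} \<le> e" by blast
next
  interpret M: prob_space M by fact
  fix a :: "'i \<Rightarrow> real"
  let ?U = "\<lambda>t \<omega>. \<Sum>j\<in>J. a j * X t j \<omega>" and ?V = "\<lambda>t \<omega>. \<Sum>j\<in>J. a j * X' t j \<omega>"
  define s where "s = 1 + (\<Sum>j\<in>J. \<bar>a j\<bar>)"
  have s: "0 < s" unfolding s_def by (intro add_pos_nonneg sum_nonneg) auto
  have "((\<lambda>t. char (distr M borel (?U t)) 1 - char (distr M borel (?V t)) 1) \<longlongrightarrow> 0) at_top"
  proof (rule tendstoI)
    fix r :: real assume "0 < r"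
    define e where "e = r / 2"
    have e: "0 < e" "e < r" using \<open>0 < r\<close> by (auto simp: e_def)
    have "((\<lambda>t. e + 2 * (\<Sum>j\<in>J. measure M {\<omega> \<in> space M. \<bar>X t j \<omega> - X' t j \<omega>\<bar> > e / s})) \<longlongrightarrow> e + 2 * (\<Sum>j\<in>J. 0)) at_top"
      using e s by (intro tendsto_intros close) auto
    then have "\<forall>\<^sub>F t in at_top. e + 2 * (\<Sum>j\<in>J. measure M {\<omega> \<in> space M. \<bar>X t j \<omega> - X' t j \<omega>\<bar> > e / s}) < r"
      using e by (intro order_tendstoD) auto
    then show "\<forall>\<^sub>F t in at_top. dist (char (distr M borel (?U t)) 1 - char (distr M borel (?V t)) 1) 0 < r"
    proof eventually_elim
      case (elim t)
      let ?A = "\<lambda>j. {\<omega> \<in> space M. \<bar>X t j \<omega> - X' t j \<omega>\<bar> > e / s}"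
      have "{\<omega> \<in> space M. \<bar>?U t \<omega> - ?V t \<omega>\<bar> > e} \<subseteq> (\<Union>j\<in>J. ?A j)"
      proof
        fix \<omega> assume \<omega>: "\<omega> \<in> {\<omega> \<in> space M. \<bar>?U t \<omega> - ?V t \<omega>\<bar> > e}"
        show "\<omega> \<in> (\<Union>j\<in>J. ?A j)"
        proof (rule ccontr)
          assume "\<omega> \<notin> (\<Union>j\<in>J. ?A j)"
          then have le: "\<bar>X t j \<omega> - X' t j \<omega>\<bar> \<le> e / s" if "j \<in> J" for j
            using that \<omega> by (force simp: not_less)
          have "?U t \<omega> - ?V t \<omega> = (\<Sum>j\<in>J. a j * (X t j \<omega> - X' t j \<omega>))"
            by (simp add: sum_subtractf right_diff_distrib)
          then have "\<bar>?U t \<omega> - ?V t \<omega>\<bar> \<le> (\<Sum>j\<in>J. \<bar>a j * (X t j \<omega> - X' t j \<omega>)\<bar>)"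
            using sum_abs by metis
          also have "\<dots> \<le> (\<Sum>j\<in>J. \<bar>a j\<bar> * (e / s))"
            unfolding abs_mult by (intro sum_mono mult_left_mono le) auto
          also have "\<dots> = (\<Sum>j\<in>J. \<bar>a j\<bar>) * (e / s)" by (rule sum_distrib_right[symmetric])
          also have "\<dots> = (s - 1) * (e / s)" by (simp add: s_def)
          also have "\<dots> \<le> e" using s e by (simp add: field_simps)
          finally show False using \<omega> by simp
        qed
      qed
      then have "measure M {\<omega> \<in> space M. \<bar>?U t \<omega> - ?V t \<omega>\<bar> > e} \<le> measure M (\<Union>j\<in>J. ?A j)"
        using J by (intro M.finite_measure_mono sets.finite_UN) auto
      also have "\<dots> \<le> (\<Sum>j\<in>J. measure M (?A j))"
        using J by (intro M.finite_measure_subadditive_finite) auto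
      finally have p: "measure M {\<omega> \<in> space M. \<bar>?U t \<omega> - ?V t \<omega>\<bar> > e} \<le> (\<Sum>j\<in>J. measure M (?A j))" .
      have "cmod (char (distr M borel (?U t)) 1 - char (distr M borel (?V t)) 1) \<le>
          e + 2 * measure M {\<omega> \<in> space M. \<bar>?U t \<omega> - ?V t \<omega>\<bar> > e}"
        using e by (intro M.char_diff_le) auto
      then show ?case using p elim by (simp add: dist_norm)
    qed
  qed
  from tendsto_add[OF this conv[of a]]
  show "((\<lambda>t. char (distr M borel (?U t)) 1) \<longlongrightarrow> char (distr N borel (\<lambda>\<omega>. \<Sum>j\<in>J. a j * Z j \<omega>)) 1) at_top"
    by simp
qed

section \<open>The supremum of a perturbed random walk with negative drift\<close>

text \<open>For each outcome the number of \<open>j\<close> with \<open>c j < Y\<close> is at most \<open>Y / c + 1\<close>; take expectations.\<close>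

lemma (in prob_space) summable_prob_gt:
  fixes Y :: "'a \<Rightarrow> real"
  assumes Y: "integrable M Y" "\<And>\<omega>. \<omega> \<in> space M \<Longrightarrow> 0 \<le> Y \<omega>" and c: "0 < c"
  shows "summable (\<lambda>j. prob {\<omega> \<in> space M. Y \<omega> > c * real j})"
proof (rule summableI_nonneg_bounded)
  have [measurable]: "random_variable borel Y" using Y(1) by auto
  fix n
  have "(\<Sum>j<n. prob {\<omega> \<in> space M. Y \<omega> > c * real j}) =
      (\<Sum>j<n. expectation (indicator {\<omega> \<in> space M. Y \<omega> > c * real j}))"
    by (intro sum.cong refl) (auto simp: Int_def intro!: arg_cong[where f = prob])
  also have "\<dots> = expectation (\<lambda>\<omega>. \<Sum>j<n. indicator {\<omega> \<in> space M. Y \<omega> > c * real j} \<omega>)"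
    by (rule Bochner_Integration.integral_sum[symmetric]) (auto simp: emeasure_eq_measure)
  also have "\<dots> \<le> expectation (\<lambda>\<omega>. Y \<omega> / c + 1)"
  proof (rule integral_mono)
    show "integrable M (\<lambda>\<omega>. \<Sum>j<n. indicator {\<omega> \<in> space M. Y \<omega> > c * real j} \<omega> :: real)"
      by (auto simp: emeasure_eq_measure)
    show "integrable M (\<lambda>\<omega>. Y \<omega> / c + 1)" using Y(1) by auto
    fix \<omega> assume \<omega>: "\<omega> \<in> space M"
    have "(\<Sum>j<n. indicator {\<omega> \<in> space M. Y \<omega> > c * real j} \<omega>) =
        (\<Sum>j<n. if c * real j < Y \<omega> then 1 else (0::real))"
      using \<omega> by (intro sum.cong) (auto simp: indicator_def)
    also have "\<dots> = real (card {j\<in>{..<n}. c * real j < Y \<omega>})"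
      by (subst sum.If_cases) (auto simp: Int_def)
    also have "card {j\<in>{..<n}. c * real j < Y \<omega>} \<le> card {..<nat \<lceil>Y \<omega> / c\<rceil>}"
    proof (rule card_mono)
      show "{j\<in>{..<n}. c * real j < Y \<omega>} \<subseteq> {..<nat \<lceil>Y \<omega> / c\<rceil>}"
      proof safe
        fix j assume "c * real j < Y \<omega>"
        then have "real j < Y \<omega> / c" using c by (simp add: field_simps)
        then show "j < nat \<lceil>Y \<omega> / c\<rceil>" by linarith
      qed
    qed simp
    also have "real (card {..<nat \<lceil>Y \<omega> / c\<rceil>}) \<le> Y \<omega> / c + 1"
    proof -
      have "0 \<le> Y \<omega> / c" using Y(2)[OF \<omega>] c by simp
      then show ?thesis by simp
    qed
    finally show "(\<Sum>j<n. indicator {\<omega> \<in> space M. Y \<omega> > c * real j} \<omega>) \<le> Y \<omega> / c + 1" by simp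
  qed
  finally show "(\<Sum>j<n. prob {\<omega> \<in> space M. Y \<omega> > c * real j}) \<le> expectation (\<lambda>\<omega>. Y \<omega> / c + 1)" .
qed simp

text \<open>Chernoff's bound, i.e. Markov's inequality for \<open>exp (- \<Sum>X\<^sub>i)\<close>, whose mean factorizes.\<close>

lemma (in prob_space) prob_sum_le_exp:
  fixes X :: "'i \<Rightarrow> 'a \<Rightarrow> real"
  assumes indep: "indep_vars (\<lambda>_. borel) X I" and I: "finite I"
    and pos: "\<And>i \<omega>. i \<in> I \<Longrightarrow> \<omega> \<in> space M \<Longrightarrow> 0 \<le> X i \<omega>"
    and mgf: "\<And>i. i \<in> I \<Longrightarrow> expectation (\<lambda>\<omega>. exp (- X i \<omega>)) \<le> exp (- (2 * c))"
  shows "prob {\<omega> \<in> space M. (\<Sum>i\<in>I. X i \<omega>) \<le> c * real (card I)} \<le> exp (- c * real (card I))"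
proof -
  have [measurable]: "\<And>i. i \<in> I \<Longrightarrow> random_variable borel (X i)"
    using indep unfolding indep_vars_def by auto
  let ?R = "\<lambda>\<omega>. \<Sum>i\<in>I. X i \<omega>" and ?j = "real (card I)"
  have int: "integrable M (\<lambda>\<omega>. exp (- X i \<omega>))" if "i \<in> I" for i
    using that pos by (intro integrable_const_bound[where B=1]) auto
  have indep': "indep_vars (\<lambda>_. borel) (\<lambda>i \<omega>. exp (- X i \<omega>)) I"
    by (rule indep_vars_compose2[OF indep]) auto
  have R: "exp (- ?R \<omega>) = (\<Prod>i\<in>I. exp (- X i \<omega>))" for \<omega>
    using I by (simp add: exp_sum sum_negf[symmetric])
  have intR: "integrable M (\<lambda>\<omega>. exp (- ?R \<omega>))"
    unfolding R by (rule indep_vars_integrable[OF I indep' int])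
  have "expectation (\<lambda>\<omega>. exp (- ?R \<omega>)) = (\<Prod>i\<in>I. expectation (\<lambda>\<omega>. exp (- X i \<omega>)))"
    unfolding R by (rule indep_vars_lebesgue_integral[OF I indep' int])
  also have "\<dots> \<le> (\<Prod>i\<in>I. exp (- (2 * c)))"
    by (intro prod_mono conjI mgf integral_nonneg_AE) auto
  also have "\<dots> = exp (- (2 * c) * ?j)"
    by (simp add: exp_of_nat_mult[symmetric] mult.commute)
  finally have E: "expectation (\<lambda>\<omega>. exp (- ?R \<omega>)) \<le> exp (- (2 * c) * ?j)" .
  have "{\<omega> \<in> space M. ?R \<omega> \<le> c * ?j} = {\<omega> \<in> space M. exp (- ?R \<omega>) \<ge> exp (- (c * ?j))}"
    by auto
  also have "prob \<dots> \<le> expectation (\<lambda>\<omega>. exp (- ?R \<omega>)) / exp (- (c * ?j))"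
    by (rule integral_Markov_inequality_measure[OF intR, where A = "{}"]) auto
  also have "\<dots> \<le> exp (- (2 * c) * ?j) / exp (- (c * ?j))"
    using E by (intro divide_right_mono) auto
  also have "\<dots> = exp (- c * ?j)"
    by (simp add: exp_diff[symmetric] algebra_simps)
  finally show ?thesis .
qed

text \<open>By a union bound over \<open>j = m - k\<close>. The event for index \<open>k\<close> forces \<open>Y\<^sub>k > L\<close>; it also forces
\<open>Y\<^sub>k > c j\<close> unless the walk gained at most \<open>c j\<close> over the last \<open>j\<close> steps. The second bound is
summable in \<open>j\<close>, so it controls all \<open>j \<ge> K\<close> uniformly in \<open>m\<close>; the first one is then used for the finitely
many \<open>j < K\<close>, with \<open>L\<close> large. The two kinds of events are only joined by a union
bound, which accommodates arbitrary dependence between \<open>X\<^sub>k\<close> and \<open>Y\<^sub>k\<close>.\<close>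

lemma (in prob_space) perturbed_walk_tight:
  fixes X Y :: "nat \<Rightarrow> 'a \<Rightarrow> real"
  assumes indep: "indep_vars (\<lambda>_. borel) X {1..}"
    and Xpos: "\<And>k \<omega>. 1 \<le> k \<Longrightarrow> \<omega> \<in> space M \<Longrightarrow> 0 \<le> X k \<omega>"
    and mgf: "\<And>k. 1 \<le> k \<Longrightarrow> expectation (\<lambda>\<omega>. exp (- X k \<omega>)) \<le> r" and r: "r < 1"
    and Y [measurable]: "\<And>k. 1 \<le> k \<Longrightarrow> random_variable borel (Y k)"
    and Y0: "integrable M Y0" "\<And>\<omega>. \<omega> \<in> space M \<Longrightarrow> 0 \<le> Y0 \<omega>"
    and YY0: "\<And>k x. 1 \<le> k \<Longrightarrow> prob {\<omega> \<in> space M. Y k \<omega> > x} = prob {\<omega> \<in> space M. Y0 \<omega> > x}"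
    and e: "0 < e"
  obtains L where "0 \<le> L"
    "\<And>m. prob {\<omega> \<in> space M. \<exists>k\<in>{1..m}. Y k \<omega> - (\<Sum>i\<in>{k<..m}. X i \<omega>) > L} \<le> e"
proof -
  have [measurable]: "\<And>k. 1 \<le> k \<Longrightarrow> random_variable borel (X k)"
    using indep unfolding indep_vars_def by auto
  \<comment> \<open>this \<open>c\<close> is small enough for \<open>r = 1 - 2 c \<le> exp (- 2 c)\<close>\<close>
  define c where "c = (1 - r) / 2"
  have c: "0 < c" using r by (simp add: c_def)
  have mgf': "expectation (\<lambda>\<omega>. exp (- X k \<omega>)) \<le> exp (- (2 * c))" if "1 \<le> k" for k
  proof -
    have "2 * c = 1 - r" by (simp add: c_def)
    then show ?thesis using mgf[OF that] exp_ge_add_one_self[of "- (2 * c)"] by linarith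
  qed
  define b where "b j = prob {\<omega> \<in> space M. Y0 \<omega> > c * real j} + exp (- c * real j)" for j :: nat
  have "summable (\<lambda>j. exp (- c) ^ j)" using c by (intro summable_geometric) auto
  then have "summable (\<lambda>j. exp (- c * real j))"
    by (simp add: exp_of_nat_mult[symmetric] mult.commute)
  then have "summable b"
    unfolding b_def by (intro summable_add summable_prob_gt[OF Y0 c])
  then obtain K where K: "\<And>m n. K \<le> m \<Longrightarrow> norm (sum b {m..<n}) < e / 2"
    using e unfolding summable_Cauchy by (meson half_gt_zero)
  \<comment> \<open>half of \<open>e\<close> is spent on the tail \<open>j \<ge> K\<close>, the other half on the \<open>K\<close> first terms\<close>
  define d where "d = e / (2 * (real K + 1))"
  have d: "0 < d" using e by (simp add: d_def)
  have [measurable]: "random_variable borel Y0" using Y0(1) by auto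
  obtain L0 where L0: "prob {\<omega> \<in> space M. \<bar>Y0 \<omega>\<bar> > L0} \<le> d"
    using tight_single[OF _ d, of Y0] by auto
  define L where "L = max 0 L0"
  have L: "0 \<le> L" by (simp add: L_def)
  have YL: "prob {\<omega> \<in> space M. Y0 \<omega> > L} \<le> d"
  proof -
    have "prob {\<omega> \<in> space M. Y0 \<omega> > L} \<le> prob {\<omega> \<in> space M. \<bar>Y0 \<omega>\<bar> > L0}"
      by (intro finite_measure_mono) (auto simp: L_def)
    then show ?thesis using L0 by simp
  qed
  define g where "g j = (if j < K then d else b j)" for j
  have g0: "0 \<le> g j" for j using d by (simp add: g_def b_def)
  show ?thesis
  proof (rule that[OF L])
    fix m
    let ?R = "\<lambda>k \<omega>. \<Sum>i\<in>{k<..m}. X i \<omega>"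
    let ?A = "\<lambda>k. {\<omega> \<in> space M. Y k \<omega> - ?R k \<omega> > L}"
    have Rm [measurable]: "random_variable borel (?R k)" for k
      by (intro borel_measurable_sum) auto
    have ev: "?A k \<in> events" and Yev: "{\<omega> \<in> space M. Y k \<omega> > x} \<in> events" if "k \<in> {1..m}" for k x
    proof -
      have [measurable]: "random_variable borel (Y k)" using that by (intro Y) auto
      show "?A k \<in> events" "{\<omega> \<in> space M. Y k \<omega> > x} \<in> events" by measurable
    qed
    have R0: "0 \<le> ?R k \<omega>" if "\<omega> \<in> space M" for k \<omega>
      using Xpos that by (intro sum_nonneg) auto
    have A: "prob (?A k) \<le> g (m - k)" if k: "k \<in> {1..m}" for k
    proof (cases "m - k < K")
      case True
      have "prob (?A k) \<le> prob {\<omega> \<in> space M. Y k \<omega> > L}"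
      proof (rule finite_measure_mono)
        show "?A k \<subseteq> {\<omega> \<in> space M. Y k \<omega> > L}"
        proof safe
          fix \<omega> assume "\<omega> \<in> space M" "L < Y k \<omega> - ?R k \<omega>"
          then show "L < Y k \<omega>" using R0[of \<omega> k] by linarith
        qed
      qed (rule Yev[OF k])
      then show ?thesis using True YL YY0[of k L] k by (simp add: g_def)
    next
      case False
      have card: "card {k<..m} = m - k" by simp
      have "prob (?A k) \<le> prob ({\<omega> \<in> space M. Y k \<omega> > c * real (m - k)} \<union> {\<omega> \<in> space M. ?R k \<omega> \<le> c * real (m - k)})"
      proof (rule finite_measure_mono)
        show "?A k \<subseteq> {\<omega> \<in> space M. Y k \<omega> > c * real (m - k)} \<union> {\<omega> \<in> space M. ?R k \<omega> \<le> c * real (m - k)}"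
          using L by auto
      qed (intro sets.Un Yev[OF k], measurable)
      also have "\<dots> \<le> prob {\<omega> \<in> space M. Y k \<omega> > c * real (m - k)} + prob {\<omega> \<in> space M. ?R k \<omega> \<le> c * real (m - k)}"
        by (intro measure_Un_le Yev[OF k]) measurable
      also have "prob {\<omega> \<in> space M. ?R k \<omega> \<le> c * real (m - k)} \<le> exp (- c * real (m - k))"
        unfolding card[symmetric] using k
        by (intro prob_sum_le_exp indep_vars_subset[OF indep] Xpos mgf') auto
      finally show ?thesis using False YY0[of k] k by (simp add: g_def b_def)
    qed
    have "{\<omega> \<in> space M. \<exists>k\<in>{1..m}. Y k \<omega> - ?R k \<omega> > L} = (\<Union>k\<in>{1..m}. ?A k)" by auto
    also have "prob \<dots> \<le> (\<Sum>k\<in>{1..m}. prob (?A k))"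
      using ev by (intro finite_measure_subadditive_finite) auto
    also have "\<dots> \<le> (\<Sum>k\<in>{1..m}. g (m - k))" by (intro sum_mono A)
    also have "\<dots> = (\<Sum>j<m. g j)"
      by (rule sum.reindex_bij_witness[of _ "\<lambda>j. m - j" "\<lambda>k. m - k"]) auto
    also have "\<dots> \<le> (\<Sum>j\<in>{..<K} \<union> {K..<m}. g j)"
      using g0 by (intro sum_mono2) auto
    also have "\<dots> = (\<Sum>j<K. g j) + (\<Sum>j\<in>{K..<m}. g j)"
      by (intro sum.union_disjoint) auto
    also have "\<dots> = real K * d + sum b {K..<m}"
      by (simp add: g_def)
    also have "\<dots> \<le> e / 2 + e / 2"
    proof (rule add_mono)
      show "real K * d \<le> e / 2" using e by (simp add: d_def field_simps)
      show "sum b {K..<m} \<le> e / 2" using K[of K m] by simp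
    qed
    finally show "prob {\<omega> \<in> space M. \<exists>k\<in>{1..m}. Y k \<omega> - ?R k \<omega> > L} \<le> e" by simp
  qed
qed

section \<open>Powers of a characteristic function\<close>

lemma exp_minus_approx:
  fixes x :: real
  assumes "0 \<le> x"
  shows "\<bar>exp (- x) - (1 - x)\<bar> \<le> x\<^sup>2"
proof -
  have "exp (- x) \<le> 1 / (1 + x)"
    using exp_ge_add_one_self[of x] assms by (simp add: exp_minus field_simps)
  also have "\<dots> \<le> 1 - x + x\<^sup>2"
  proof -
    have "1 \<le> (1 - x + x\<^sup>2) * (1 + x)"
      using assms by (simp add: algebra_simps power2_eq_square)
    then show ?thesis using assms by (simp add: divide_le_eq)
  qed
  finally show ?thesis using exp_ge_add_one_self[of "- x"] by (simp add: abs_le_iff)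
qed

text \<open>The characteristic function at \<open>1 / sqrt t\<close> differs from \<open>exp (- v / (2 t))\<close> by \<open>o(1 / t)\<close>. Both numbers
lie in the unit disc, so their \<open>n(t)\<close>-th powers differ by at most \<open>n(t)\<close> times as much, which
tends to zero because \<open>n(t) / t\<close> is bounded. The number of steps is a general function of a real \<open>t\<close>, as the
blocks of the walk between two rescaled times require.\<close>

lemma (in prob_space) char_power_tendsto:
  fixes X :: "'a \<Rightarrow> real" and n :: "real \<Rightarrow> nat"
  assumes [measurable]: "random_variable borel X"
    and X2: "integrable M (\<lambda>\<omega>. (X \<omega>)\<^sup>2)" and X0: "expectation X = 0"
    and n: "((\<lambda>t. real (n t) / t) \<longlongrightarrow> h) at_top"
  defines "v \<equiv> expectation (\<lambda>\<omega>. (X \<omega>)\<^sup>2)"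
  shows "((\<lambda>t. char (distr M borel X) (1 / sqrt t) ^ n t) \<longlongrightarrow> of_real (exp (- (h * v / 2)))) at_top"
proof -
  define \<psi> where "\<psi> = char (distr M borel X)"
  define E where "E t = expectation (\<lambda>\<omega>. min (6 * (X \<omega>)\<^sup>2) (\<bar>1 / sqrt t\<bar> * \<bar>X \<omega>\<bar> ^ 3))" for t
  interpret D: real_distribution "distr M borel X" by (rule real_distribution_distr) simp
  have v: "0 \<le> v" unfolding v_def by (intro integral_nonneg_AE) auto
  have X1: "integrable M X"
    by (rule square_integrable_imp_integrable[OF _ X2]) simp
  have var: "variance X = v" by (simp add: X0 v_def)
  have E: "(E \<longlongrightarrow> expectation (\<lambda>\<omega>. 0)) at_top"
    unfolding E_def
  proof (rule integral_dominated_convergence_at_top[where w = "\<lambda>\<omega>. 6 * (X \<omega>)\<^sup>2"])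
    show "AE \<omega> in M. ((\<lambda>t. min (6 * (X \<omega>)\<^sup>2) (\<bar>1 / sqrt t\<bar> * \<bar>X \<omega>\<bar> ^ 3)) \<longlongrightarrow> 0) at_top"
    proof (rule AE_I2)
      fix \<omega>
      have "((\<lambda>t. 1 / sqrt t) \<longlongrightarrow> 0) at_top"
        by (rule tendsto_divide_0[OF tendsto_const filterlim_at_top_imp_at_infinity[OF sqrt_at_top]])
      then have "((\<lambda>t. min (6 * (X \<omega>)\<^sup>2) (\<bar>1 / sqrt t\<bar> * \<bar>X \<omega>\<bar> ^ 3)) \<longlongrightarrow> min (6 * (X \<omega>)\<^sup>2) (\<bar>0\<bar> * \<bar>X \<omega>\<bar> ^ 3)) at_top"
        by (intro tendsto_intros)
      then show "((\<lambda>t. min (6 * (X \<omega>)\<^sup>2) (\<bar>1 / sqrt t\<bar> * \<bar>X \<omega>\<bar> ^ 3)) \<longlongrightarrow> 0) at_top" by simp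
    qed
    show "\<forall>\<^sub>F t in at_top. AE \<omega> in M. norm (min (6 * (X \<omega>)\<^sup>2) (\<bar>1 / sqrt t\<bar> * \<bar>X \<omega>\<bar> ^ 3)) \<le> 6 * (X \<omega>)\<^sup>2"
      by (intro always_eventually allI AE_I2) (simp add: abs_of_nonneg)
  qed (use X2 in auto)
  have bound: "\<forall>\<^sub>F t in at_top. cmod (\<psi> (1 / sqrt t) ^ n t - of_real (exp (- (v / (2 * t)))) ^ n t)
      \<le> (real (n t) / t) * (E t / 6 + v\<^sup>2 / 4 * (1 / t))"
    using eventually_gt_at_top[of 0]
  proof eventually_elim
    case (elim t)
    let ?\<theta> = "1 / sqrt t" and ?w = "complex_of_real (exp (- (v / (2 * t))))"
    have sq: "?\<theta>\<^sup>2 = 1 / t" using elim by (simp add: power_divide)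
    have "cmod (\<psi> ?\<theta> - (1 - ?\<theta>\<^sup>2 * v / 2)) \<le> ?\<theta>\<^sup>2 / 6 * E t"
      using char_approx3'[OF assms(1) X1 X2 X0 var refl, of "1 / sqrt t"]
      unfolding E_def \<psi>_def by simp
    then have 1: "cmod (\<psi> ?\<theta> - of_real (1 - v / (2 * t))) \<le> 1 / t * (E t / 6)"
      unfolding sq by (simp add: field_simps)
    have "cmod (?w - of_real (1 - v / (2 * t))) \<le> (v / (2 * t))\<^sup>2"
      using exp_minus_approx[of "v / (2 * t)"] v elim
      by (simp only: of_real_diff[symmetric] norm_of_real) simp
    then have 2: "cmod (of_real (1 - v / (2 * t)) - ?w) \<le> 1 / t * (v\<^sup>2 / 4 * (1 / t))"
      by (subst norm_minus_commute) (simp add: power2_eq_square)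
    have "cmod (\<psi> ?\<theta> - ?w) \<le> 1 / t * (E t / 6) + 1 / t * (v\<^sup>2 / 4 * (1 / t))"
      using norm_triangle_ineq[of "\<psi> ?\<theta> - of_real (1 - v / (2 * t))" "of_real (1 - v / (2 * t)) - ?w"] 1 2
      by simp
    also have "\<dots> = 1 / t * (E t / 6 + v\<^sup>2 / 4 * (1 / t))" by (simp only: distrib_left)
    finally have 3: "cmod (\<psi> ?\<theta> - ?w) \<le> 1 / t * (E t / 6 + v\<^sup>2 / 4 * (1 / t))" .
    have "cmod (\<psi> ?\<theta> ^ n t - ?w ^ n t) \<le> n t * cmod (\<psi> ?\<theta> - ?w)"
      using v elim by (intro norm_power_diff) (auto simp: \<psi>_def D.cmod_char_le_1)
    also have "\<dots> \<le> n t * (1 / t * (E t / 6 + v\<^sup>2 / 4 * (1 / t)))"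
      using 3 by (intro mult_left_mono) auto
    finally show ?case by simp
  qed
  have "((\<lambda>t. (real (n t) / t) * (E t / 6 + v\<^sup>2 / 4 * (1 / t))) \<longlongrightarrow> h * (expectation (\<lambda>\<omega>. 0) / 6 + v\<^sup>2 / 4 * 0)) at_top"
    by (intro tendsto_intros n E tendsto_divide_0[OF tendsto_const] filterlim_at_top_imp_at_infinity filterlim_ident) auto
  then have "((\<lambda>t. \<psi> (1 / sqrt t) ^ n t - of_real (exp (- (v / (2 * t)))) ^ n t) \<longlongrightarrow> 0) at_top"
    by (intro Lim_null_comparison[OF bound]) simp
  moreover have "((\<lambda>t. of_real (exp (- (v / (2 * t)))) ^ n t) \<longlongrightarrow> complex_of_real (exp (- (h * v / 2)))) at_top"
  proof -
    have "((\<lambda>t. complex_of_real (exp (- (real (n t) / t * v / 2)))) \<longlongrightarrow> of_real (exp (- (h * v / 2)))) at_top"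
      by (intro tendsto_intros n) auto
    moreover have "complex_of_real (exp (- (real (n t) / t * v / 2))) = of_real (exp (- (v / (2 * t)))) ^ n t" for t
    proof -
      have "exp (- (real (n t) / t * v / 2)) = exp (real (n t) * (- (v / (2 * t))))"
        by (simp add: mult.commute)
      then show ?thesis by (simp only: exp_of_nat_mult of_real_power)
    qed
    ultimately show ?thesis by simp
  qed
  ultimately have "((\<lambda>t. (\<psi> (1 / sqrt t) ^ n t - of_real (exp (- (v / (2 * t)))) ^ n t)
      + of_real (exp (- (v / (2 * t)))) ^ n t) \<longlongrightarrow> 0 + complex_of_real (exp (- (h * v / 2)))) at_top"
    by (rule tendsto_add)
  then show ?thesis by (simp add: \<psi>_def)
qed

lemma (in prob_space) second_moment_sum_indep:
  fixes X :: "'i \<Rightarrow> 'a \<Rightarrow> real"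
  assumes "finite I" "indep_vars (\<lambda>_. borel) X I"
    and "\<And>i. i \<in> I \<Longrightarrow> integrable M (\<lambda>\<omega>. (X i \<omega>)\<^sup>2)" "\<And>i. i \<in> I \<Longrightarrow> expectation (X i) = 0"
  shows "integrable M (\<lambda>\<omega>. (\<Sum>i\<in>I. X i \<omega>)\<^sup>2) \<and>
    expectation (\<lambda>\<omega>. (\<Sum>i\<in>I. X i \<omega>)\<^sup>2) = (\<Sum>i\<in>I. expectation (\<lambda>\<omega>. (X i \<omega>)\<^sup>2))"
  using assms
proof (induction I rule: finite_induct)
  case (insert i I)
  have rv [measurable]: "random_variable borel (X j)" if "j \<in> insert i I" for j
    using insert.prems(1) that unfolding indep_vars_def by auto
  have int1: "integrable M (X j)" if "j \<in> insert i I" for j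
    using rv[OF that] insert.prems(2)[OF that] by (rule square_integrable_imp_integrable)
  have IH: "integrable M (\<lambda>\<omega>. (\<Sum>i\<in>I. X i \<omega>)\<^sup>2)"
    "expectation (\<lambda>\<omega>. (\<Sum>i\<in>I. X i \<omega>)\<^sup>2) = (\<Sum>i\<in>I. expectation (\<lambda>\<omega>. (X i \<omega>)\<^sup>2))"
    using insert.IH[OF indep_vars_subset[OF insert.prems(1)]] insert.prems(2,3) by auto
  have ind: "indep_var borel (X i) borel (\<lambda>\<omega>. \<Sum>i\<in>I. X i \<omega>)"
    by (rule indep_vars_sum[OF insert.hyps insert.prems(1)])
  have intS: "integrable M (\<lambda>\<omega>. \<Sum>i\<in>I. X i \<omega>)" using int1 by auto
  have iXS: "integrable M (\<lambda>\<omega>. X i \<omega> * (\<Sum>i\<in>I. X i \<omega>))"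
    by (rule indep_var_integrable[OF ind int1[OF insertI1] intS])
  have eXS: "expectation (\<lambda>\<omega>. X i \<omega> * (\<Sum>i\<in>I. X i \<omega>)) = 0"
    by (subst indep_var_lebesgue_integral[OF ind int1[OF insertI1] intS]) (simp add: insert.prems(3))
  have sq: "(\<Sum>j\<in>insert i I. X j \<omega>)\<^sup>2 =
      (X i \<omega>)\<^sup>2 + 2 * (X i \<omega> * (\<Sum>i\<in>I. X i \<omega>)) + (\<Sum>i\<in>I. X i \<omega>)\<^sup>2" for \<omega>
    using insert.hyps by (simp add: power2_sum)
  show ?case
    unfolding sq using insert.hyps insert.prems(2)[OF insertI1] iXS eXS IH by simp
qed simp

lemma floor_mult_over_tendsto:
  assumes "0 \<le> u"
  shows "((\<lambda>t. real (nat \<lfloor>t * u\<rfloor>) / t) \<longlongrightarrow> u) at_top"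
proof -
  have "\<forall>\<^sub>F t in at_top. norm (real (nat \<lfloor>t * u\<rfloor>) / t - u) \<le> 1 / t"
    using eventually_gt_at_top[of "0::real"]
  proof eventually_elim
    case (elim t)
    have "0 \<le> t * u" using elim assms by simp
    then have "\<bar>real (nat \<lfloor>t * u\<rfloor>) - t * u\<bar> \<le> 1" by linarith
    moreover have "real (nat \<lfloor>t * u\<rfloor>) / t - u = (real (nat \<lfloor>t * u\<rfloor>) - t * u) / t"
      using elim by (simp add: diff_divide_distrib)
    ultimately show ?case using elim by (simp add: divide_right_mono)
  qed
  moreover have "((\<lambda>t::real. 1 / t) \<longlongrightarrow> 0) at_top"
    by (rule tendsto_divide_0[OF tendsto_const filterlim_at_top_imp_at_infinity[OF filterlim_ident]])
  ultimately have "((\<lambda>t. real (nat \<lfloor>t * u\<rfloor>) / t - u) \<longlongrightarrow> 0) at_top"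
    by (rule Lim_null_comparison)
  then show ?thesis by (simp add: LIM_zero_iff)
qed

section \<open>Time grids and Gaussian increments\<close>

text \<open>Each value \<open>F u q\<close> at a grid time is the telescoping sum of the increments of \<open>F\<close> over the grid
intervals below \<open>u\<close>. The weight of an increment collects the coefficients of all later times.\<close>

lemma sum_by_parts_on_grid:
  fixes a F :: "_ \<Rightarrow> _ \<Rightarrow> real" and s :: "nat \<Rightarrow> real"
  assumes J: "finite J" and s: "strict_mono_on {..m} s" and p: "inj_on p I" and I: "finite I"
    and grid: "J \<subseteq> (s ` {..m}) \<times> (p ` I)" and F0: "\<And>i. i \<in> I \<Longrightarrow> F (s 0) (p i) = 0"
  shows "(\<Sum>(u, q)\<in>J. a u q * F u q) =
    (\<Sum>k<m. \<Sum>i\<in>I. (\<Sum>(u, q)\<in>J. if q = p i \<and> s k < u then a u q else 0)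
        * (F (s (Suc k)) (p i) - F (s k) (p i)))"
proof -
  let ?d = "\<lambda>k i. F (s (Suc k)) (p i) - F (s k) (p i)"
  have one: "(\<Sum>k<m. \<Sum>i\<in>I. (if q = p i \<and> s k < u then a u q else 0) * ?d k i) = a u q * F u q"
    if "(u, q) \<in> J" for u q
  proof -
    have "(u, q) \<in> (s ` {..m}) \<times> (p ` I)" by (rule subsetD[OF grid that])
    then obtain l i0 where l: "l \<le> m" "u = s l" and i0: "i0 \<in> I" "q = p i0"
      by auto
    have pq: "q = p i \<longleftrightarrow> i = i0" if "i \<in> I" for i
      using inj_on_eq_iff[OF p that i0(1)] i0(2) by auto
    have inner: "(\<Sum>i\<in>I. (if q = p i \<and> s k < u then a u q else 0) * ?d k i) =
        (if k < l then a u q * ?d k i0 else 0)" if k: "k < m" for k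
    proof -
      have less: "s k < u \<longleftrightarrow> k < l"
        using strict_mono_on_less[OF s, of k l] l k by simp
      have "(\<Sum>i\<in>I. (if q = p i \<and> s k < u then a u q else 0) * ?d k i) =
          (\<Sum>i\<in>I. if i = i0 then (if k < l then a u q * ?d k i0 else 0) else 0)"
      proof (intro sum.cong refl)
        fix i assume "i \<in> I"
        show "(if q = p i \<and> s k < u then a u q else 0) * ?d k i =
            (if i = i0 then (if k < l then a u q * ?d k i0 else 0) else 0)"
          unfolding pq[OF \<open>i \<in> I\<close>] less by simp
      qed
      also have "\<dots> = (if k < l then a u q * ?d k i0 else 0)" using I i0(1) by (simp only: sum.delta if_True)
      finally show ?thesis .
    qed
    have "(\<Sum>k<m. \<Sum>i\<in>I. (if q = p i \<and> s k < u then a u q else 0) * ?d k i) =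
        (\<Sum>k<m. if k < l then a u q * ?d k i0 else 0)"
      by (intro sum.cong refl inner) simp
    also have "\<dots> = (\<Sum>k\<in>{k\<in>{..<m}. k < l}. a u q * ?d k i0)"
      by (rule sum.inter_filter[symmetric]) simp
    also have "{k\<in>{..<m}. k < l} = {..<l}"
      using l(1) by auto
    also have "(\<Sum>k<l. a u q * ?d k i0) = a u q * (\<Sum>k<l. ?d k i0)"
      by (rule sum_distrib_left[symmetric])
    also have "(\<Sum>k<l. ?d k i0) = F (s l) (p i0) - F (s 0) (p i0)"
      by (rule sum_lessThan_telescope)
    also have "a u q * (F (s l) (p i0) - F (s 0) (p i0)) = a u q * F u q" using F0[OF i0(1)] l i0 by simp
    finally show ?thesis .
  qed
  have "(\<Sum>k<m. \<Sum>i\<in>I. (\<Sum>(u, q)\<in>J. if q = p i \<and> s k < u then a u q else 0) * ?d k i) =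
      (\<Sum>k<m. \<Sum>i\<in>I. \<Sum>(u, q)\<in>J. (if q = p i \<and> s k < u then a u q else 0) * ?d k i)"
    by (simp only: sum_distrib_right case_prod_unfold)
  also have "\<dots> = (\<Sum>k<m. \<Sum>(u, q)\<in>J. \<Sum>i\<in>I. (if q = p i \<and> s k < u then a u q else 0) * ?d k i)"
    unfolding case_prod_unfold by (intro sum.cong refl sum.swap)
  also have "\<dots> = (\<Sum>(u, q)\<in>J. \<Sum>k<m. \<Sum>i\<in>I. (if q = p i \<and> s k < u then a u q else 0) * ?d k i)"
    unfolding case_prod_unfold by (rule sum.swap)
  also have "\<dots> = (\<Sum>(u, q)\<in>J. a u q * F u q)"
  proof (intro sum.cong refl, clarify)
    fix u q assume "(u, q) \<in> J"
    then show "(\<Sum>k<m. \<Sum>i\<in>I. (if q = p i \<and> s k < u then a u q else 0) * ?d k i) = a u q * F u q"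
      by (rule one)
  qed
  finally show ?thesis by (rule sym)
qed

lemma finite_linorder_enumeration:
  fixes A :: "'a::linorder set"
  assumes "finite A"
  obtains h where "h ` {..<card A} = A" "strict_mono_on {..<card A} h"
proof -
  obtain l where l: "sorted_wrt (<) l" "set l = A" "length l = card A"
    using assms by (rule finite_set_strict_sorted)
  show ?thesis
  proof
    show "(!) l ` {..<card A} = A"
      using l(2,3) by (auto simp: set_conv_nth image_iff)
    show "strict_mono_on {..<card A} ((!) l)"
      using l by (auto simp: strict_mono_on_def sorted_wrt_iff_nth_less)
  qed
qed

text \<open>Time \<open>0\<close> starts the grid, so that the processes vanish at its first point, and the prime \<open>2\<close> is always
included, so that there is at least one coordinate.\<close>

lemma time_prime_grid:
  fixes J :: "(real \<times> nat) set"
  assumes "finite J" "J \<subseteq> {0..} \<times> {p. prime p}"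
  obtains s :: "nat \<Rightarrow> real" and m n :: nat and p :: "nat \<Rightarrow> nat" where
    "s 0 = 0" "strict_mono_on {..m} s" "1 \<le> n" "strict_mono_on {1..n} p"
    "\<And>i. i \<in> {1..n} \<Longrightarrow> prime (p i)" "J \<subseteq> (s ` {..m}) \<times> (p ` {1..n})"
proof -
  define U where "U = insert 0 (fst ` J)"
  define P where "P = insert 2 (snd ` J)"
  have fin: "finite U" "finite P" using assms(1) by (auto simp: U_def P_def)
  have U0: "0 \<le> u" if "u \<in> U" for u using assms(2) that by (auto simp: U_def)
  have P: "prime q" if "q \<in> P" for q using assms(2) that by (auto simp: P_def)
  have "card U \<noteq> 0" "card P \<noteq> 0" using fin by (auto simp: U_def P_def)
  then obtain m n' where m: "card U = Suc m" and n': "card P = Suc n'"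
    by (metis not0_implies_Suc)
  obtain s where s: "s ` {..<card U} = U" "strict_mono_on {..<card U} s"
    using fin(1) by (rule finite_linorder_enumeration)
  obtain h where h: "h ` {..<card P} = P" "strict_mono_on {..<card P} h"
    using fin(2) by (rule finite_linorder_enumeration)
  have sU: "s ` {..m} = U" "strict_mono_on {..m} s"
    using s by (simp_all add: m lessThan_Suc_atMost)
  define p where "p i = h (i - 1)" for i :: nat
  have im: "p ` {1..card P} = P"
  proof -
    have "(\<lambda>i. i - 1) ` {1..card P} = {..<card P}"
    proof safe
      fix i assume "i < card P"
      then show "i \<in> (\<lambda>i. i - 1) ` {1..card P}" by (intro image_eqI[of _ _ "Suc i"]) auto
    qed auto
    moreover have "p ` {1..card P} = h ` ((\<lambda>i. i - 1) ` {1..card P})"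
      by (simp add: image_image p_def)
    ultimately show ?thesis using h(1) by simp
  qed
  show ?thesis
  proof (rule that[of s m "card P" p])
    obtain k where k: "k \<le> m" "s k = 0"
    proof -
      have "0 \<in> s ` {..m}" unfolding sU(1) by (simp add: U_def)
      then show ?thesis using that by auto
    qed
    have "s 0 \<in> U" using sU(1) by blast
    then have "0 \<le> s 0" by (rule U0)
    moreover have "s 0 \<le> s k"
      using strict_mono_on_leD[OF sU(2), of 0 k] k(1) by simp
    ultimately show "s 0 = 0" using k(2) by simp
    show "strict_mono_on {..m} s" by fact
    show "1 \<le> card P" by (simp add: n')
    show "strict_mono_on {1..card P} p"
      unfolding p_def by (rule strict_mono_onI, rule strict_mono_onD[OF h(2)]) auto
    show "prime (p i)" if "i \<in> {1..card P}" for i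
    proof (rule P)
      have "p i \<in> p ` {1..card P}" using that by (rule imageI)
      then show "p i \<in> P" by (simp only: im)
    qed
    show "J \<subseteq> (s ` {..m}) \<times> (p ` {1..card P})"
      unfolding sU(1) im by (force simp: U_def P_def)
  qed
qed

lemma char_normal_law:
  assumes "0 \<le> v"
  shows "char (normal_law 0 v) 1 = of_real (exp (- v / 2))"
proof (cases "v = 0")
  case True
  then show ?thesis by (simp add: normal_law_def char_def integral_return)
next
  case False
  with assms have s: "0 < sqrt v" by simp
  interpret S: prob_space std_normal_distribution
    by (rule prob_space_normal_density) simp
  have "distributed std_normal_distribution lborel (\<lambda>x. x) std_normal_density"
    by (auto simp: distributed_def distr_id2)
  then have "distributed std_normal_distribution lborel (\<lambda>x. 0 + sqrt v * x)
      (normal_density (0 + sqrt v * 0) (\<bar>sqrt v\<bar> * 1))"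
    using s by (intro S.normal_density_affine) auto
  then have "distr std_normal_distribution lborel (\<lambda>x. sqrt v * x) = density lborel (normal_density 0 (sqrt v))"
    using assms by (simp add: distributed_def)
  then have "normal_law 0 v = distr std_normal_distribution borel (\<lambda>x. sqrt v * x)"
    using False by (simp add: normal_law_def cong: distr_cong)
  then have "char (normal_law 0 v) 1 = char std_normal_distribution (sqrt v)"
    by (simp add: char_def integral_distr)
  also have "\<dots> = of_real (exp (- v / 2))"
    using assms by (simp add: char_std_normal_distribution)
  finally show ?thesis .
qed

text \<open>The increments over the grid intervals are independent, and each is distributed as the value of
the process at the length of the interval, whose linear combinations are normal.\<close>

lemma wiener_increments_char:
  assumes W: "wiener_process N n C W"
    and s: "0 \<le> s 0" "\<And>k. k < m \<Longrightarrow> s k < s (Suc k)"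
    and C: "\<And>k. k < m \<Longrightarrow> 0 \<le> (\<Sum>i\<in>{1..n}. \<Sum>j\<in>{1..n}. A k i * A k j * C i j)"
  shows "char (distr N borel (\<lambda>\<omega>. \<Sum>k<m. \<Sum>i\<in>{1..n}. A k i * (W i (s (Suc k)) \<omega> - W i (s k) \<omega>))) 1 =
    (\<Prod>k<m. of_real (exp (- ((s (Suc k) - s k) * (\<Sum>i\<in>{1..n}. \<Sum>j\<in>{1..n}. A k i * A k j * C i j) / 2))))"
proof -
  interpret N: prob_space N using W by (simp add: wiener_process_def)
  have Wm: "W i u \<in> borel_measurable N" if "i \<in> {1..n}" "0 \<le> u" for i u
    using W that by (simp add: wiener_process_def)
  have W0: "AE \<omega> in N. \<forall>i\<in>{1..n}. W i 0 \<omega> = 0"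
  proof -
    have "AE \<omega> in N. \<forall>i\<in>{1..n}. W i 0 \<omega> = 0 \<and> continuous_on {0..} (\<lambda>u. W i u \<omega>)"
      using W unfolding wiener_process_def by blast
    then show ?thesis by eventually_elim blast
  qed
  let ?P = "PiM {1..n} (\<lambda>_. borel :: real measure)"
  let ?I = "\<lambda>k \<omega>. \<lambda>i\<in>{1..n}. W i (s (Suc k)) \<omega> - W i (s k) \<omega>"
  have sn: "0 \<le> s k" if "k \<le> m" for k
    using that
  proof (induction k)
    case (Suc k) then show ?case using s(2)[of k] by simp
  qed (use s(1) in simp)
  have lin: "(\<lambda>x. \<Sum>i\<in>{1..n}. b i * x i) \<in> borel_measurable ?P" for b :: "nat \<Rightarrow> real"
    by (intro borel_measurable_sum borel_measurable_times measurable_component_singleton) auto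
  have eq: "(\<Sum>i\<in>{1..n}. b i * (\<lambda>i\<in>{1..n}. f i) i) = (\<Sum>i\<in>{1..n}. b i * f i)" for b f :: "nat \<Rightarrow> real"
    by (intro sum.cong) auto
  have "N.indep_vars (\<lambda>_. ?P) ?I {..<m}"
    using W s unfolding wiener_process_def by blast
  then have "N.indep_vars (\<lambda>_. borel) (\<lambda>k \<omega>. \<Sum>i\<in>{1..n}. A k i * ?I k \<omega> i) {..<m}"
    by (rule N.indep_vars_compose2) (rule lin)
  then have ind: "N.indep_vars (\<lambda>_. borel) (\<lambda>k \<omega>. \<Sum>i\<in>{1..n}. A k i * (W i (s (Suc k)) \<omega> - W i (s k) \<omega>)) {..<m}"
    unfolding eq .
  have one: "char (distr N borel (\<lambda>\<omega>. \<Sum>i\<in>{1..n}. A k i * (W i (s (Suc k)) \<omega> - W i (s k) \<omega>))) 1 =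
     of_real (exp (- ((s (Suc k) - s k) * (\<Sum>i\<in>{1..n}. \<Sum>j\<in>{1..n}. A k i * A k j * C i j) / 2)))"
    if k: "k < m" for k
  proof -
    define h where "h = s (Suc k) - s k"
    have h: "0 \<le> h" "s (Suc k) = s k + h" "0 \<le> s k" "0 \<le> s (Suc k)"
      using s(2)[OF k] sn[of k] sn[of "Suc k"] k by (auto simp: h_def)
    have mI: "?I k \<in> measurable N ?P"
      using h by (intro measurable_restrict borel_measurable_diff Wm) auto
    have mH: "(\<lambda>\<omega>. \<lambda>i\<in>{1..n}. W i h \<omega> - W i 0 \<omega>) \<in> measurable N ?P"
      using h by (intro measurable_restrict borel_measurable_diff Wm) auto
    have d: "distr N ?P (?I k) = distr N ?P (\<lambda>\<omega>. \<lambda>i\<in>{1..n}. W i h \<omega> - W i 0 \<omega>)"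
      using W h(1,3) unfolding wiener_process_def h(2) by blast
    have "distr N borel (\<lambda>\<omega>. \<Sum>i\<in>{1..n}. A k i * (W i (s (Suc k)) \<omega> - W i (s k) \<omega>)) =
        distr (distr N ?P (?I k)) borel (\<lambda>x. \<Sum>i\<in>{1..n}. A k i * x i)"
      unfolding distr_distr[OF lin mI] comp_def eq ..
    also have "\<dots> = distr N borel (\<lambda>\<omega>. \<Sum>i\<in>{1..n}. A k i * (W i h \<omega> - W i 0 \<omega>))"
      unfolding d distr_distr[OF lin mH] comp_def eq ..
    also have "\<dots> = distr N borel (\<lambda>\<omega>. \<Sum>i\<in>{1..n}. A k i * W i h \<omega>)"
    proof (rule distr_cong_AE)
      show "AE \<omega> in N. (\<Sum>i\<in>{1..n}. A k i * (W i h \<omega> - W i 0 \<omega>)) = (\<Sum>i\<in>{1..n}. A k i * W i h \<omega>)"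
        using W0 by eventually_elim (auto intro!: sum.cong)
    qed (use h Wm in \<open>auto intro!: borel_measurable_sum borel_measurable_times borel_measurable_diff\<close>)
    also have "\<dots> = normal_law 0 (\<Sum>i\<in>{1..n}. \<Sum>j\<in>{1..n}. A k i * A k j * (h * C i j))"
      using W h(1) by (simp add: wiener_process_def gaussian_vector_def)
    also have "(\<Sum>i\<in>{1..n}. \<Sum>j\<in>{1..n}. A k i * A k j * (h * C i j)) =
        h * (\<Sum>i\<in>{1..n}. \<Sum>j\<in>{1..n}. A k i * A k j * C i j)"
      by (simp add: sum_distrib_left mult_ac)
    finally show ?thesis
      using C[OF k] h(1) by (simp add: char_normal_law h_def)
  qed
  have "char (distr N borel (\<lambda>\<omega>. \<Sum>k<m. \<Sum>i\<in>{1..n}. A k i * (W i (s (Suc k)) \<omega> - W i (s k) \<omega>))) 1 =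
      (\<Prod>k<m. char (distr N borel (\<lambda>\<omega>. \<Sum>i\<in>{1..n}. A k i * (W i (s (Suc k)) \<omega> - W i (s k) \<omega>))) 1)"
    by (rule N.char_distr_sum[OF ind])
  also have "\<dots> = (\<Prod>k<m. of_real (exp (- ((s (Suc k) - s k) * (\<Sum>i\<in>{1..n}. \<Sum>j\<in>{1..n}. A k i * A k j * C i j) / 2))))"
    by (intro prod.cong one) auto
  finally show ?thesis .
qed

section \<open>The walk of prime multiplicities\<close>

lemma multiplicity_prod_nat:
  fixes f :: "'i \<Rightarrow> nat"
  assumes "prime p" "finite A" "\<And>i. i \<in> A \<Longrightarrow> f i \<noteq> 0"
  shows "multiplicity p (\<Prod>i\<in>A. f i) = (\<Sum>i\<in>A. multiplicity p (f i))"
  using assms(2,3)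
proof (induction A rule: finite_induct)
  case (insert i A)
  then show ?case
    using \<open>prime p\<close> by (simp add: prime_elem_multiplicity_mult_distrib)
qed simp

lemma multiplicity_mult_ln_le:
  fixes p n :: nat
  assumes "prime p" "1 \<le> n"
  shows "real (multiplicity p n) * ln 2 \<le> ln (real n)"
proof -
  have "2 ^ multiplicity p n \<le> p ^ multiplicity p n"
    using prime_ge_2_nat[OF \<open>prime p\<close>] by (rule power_mono) simp
  also have "\<dots> \<le> n"
    using assms(2) by (intro dvd_imp_le multiplicity_dvd) simp
  finally have "(2::real) ^ multiplicity p n \<le> real n"
    by (metis of_nat_le_iff of_nat_numeral of_nat_power)
  then have "ln ((2::real) ^ multiplicity p n) \<le> ln (real n)"
    using assms(2) by (subst ln_le_cancel_iff) auto
  then show ?thesis by (simp add: ln_realpow)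
qed

text \<open>Needed to index the steps of the walk by pairs of a block and a position in it.\<close>

lemma (in prob_space) indep_vars_reindex_inj:
  assumes f: "inj_on f I" and ind: "indep_vars (\<lambda>_. N) X (f ` I)"
  shows "indep_vars (\<lambda>_. N) (\<lambda>i. X (f i)) I"
  unfolding indep_vars_def2
proof (intro conjI ballI indep_setsI)
  let ?E = "\<lambda>j. {X j -` B \<inter> space M |B. B \<in> sets N}"
  have rv: "random_variable N (X (f i))" if "i \<in> I" for i
    using ind that unfolding indep_vars_def2 by blast
  have sets: "indep_sets ?E (f ` I)"
    using ind unfolding indep_vars_def2 by blast
  show "random_variable N (X (f i))" if "i \<in> I" for i by (rule rv[OF that])
  show "?E (f i) \<subseteq> events" if "i \<in> I" for i
    using measurable_sets[OF rv[OF that]] by blast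
  fix A J assume J: "J \<noteq> {}" "J \<subseteq> I" "finite J" "\<forall>j\<in>J. A j \<in> ?E (f j)"
  have fJ: "inj_on f J" using f J(2) by (rule inj_on_subset)
  define A' where "A' = (\<lambda>l. A (the_inv_into J f l))"
  have A': "A' (f j) = A j" if "j \<in> J" for j
    using the_inv_into_f_f[OF fJ that] by (simp add: A'_def)
  have "prob (\<Inter>l\<in>f ` J. A' l) = (\<Prod>l\<in>f ` J. prob (A' l))"
    by (rule indep_setsD[OF sets]) (use J A' in auto)
  then show "prob (\<Inter>j\<in>J. A j) = (\<Prod>j\<in>J. prob (A j))"
    by (simp add: A' prod.reindex[OF fJ])
qed

text \<open>Laws and integrals are transferred from \<open>(\<xi>, \<eta>)\<close> to its copies through real functions \<open>g\<close> of
the pair, which treats the multiplicities in \<open>\<xi>\<close>, those in \<open>\<eta>\<close> and their combinations alike.\<close>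

locale prime_factor_walk = prob_space M for M :: "'a measure" +
  fixes \<xi> \<eta> :: "'a \<Rightarrow> nat" and \<xi>s \<eta>s :: "nat \<Rightarrow> 'a \<Rightarrow> nat"
  assumes \<xi>_rv: "\<xi> \<in> measurable M (count_space UNIV)"
    and \<eta>_rv: "\<eta> \<in> measurable M (count_space UNIV)"
    and generic_pos: "\<And>\<omega>. \<omega> \<in> space M \<Longrightarrow> \<xi> \<omega> \<ge> 1 \<and> \<eta> \<omega> \<ge> 1"
    and copies_pos: "\<And>k \<omega>. k \<ge> 1 \<Longrightarrow> \<omega> \<in> space M \<Longrightarrow> \<xi>s k \<omega> \<ge> 1 \<and> \<eta>s k \<omega> \<ge> 1"
    and copies_indep: "indep_vars (\<lambda>_. count_space UNIV) (\<lambda>k \<omega>. (\<xi>s k \<omega>, \<eta>s k \<omega>)) {1..}"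
    and copies_distr: "\<And>k. k \<ge> 1 \<Longrightarrow>
      distr M (count_space UNIV) (\<lambda>\<omega>. (\<xi>s k \<omega>, \<eta>s k \<omega>)) =
      distr M (count_space UNIV) (\<lambda>\<omega>. (\<xi> \<omega>, \<eta> \<omega>))"
    and ln_\<xi>_sq: "integrable M (\<lambda>\<omega>. (ln (real (\<xi> \<omega>)))\<^sup>2)"
    and mult_\<eta>: "\<And>p. prime p \<Longrightarrow> integrable M (\<lambda>\<omega>. real (multiplicity p (\<eta> \<omega>)))"
    and dvd_\<xi>: "\<And>p. prime p \<Longrightarrow> measure M {\<omega> \<in> space M. p dvd \<xi> \<omega>} > 0"
begin

abbreviation "\<mu> p \<equiv> \<integral>\<omega>. real (multiplicity p (\<xi> \<omega>)) \<partial>M"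

lemma pair_rv: "(\<lambda>\<omega>. (\<xi> \<omega>, \<eta> \<omega>)) \<in> measurable M (count_space UNIV)"
proof -
  have "(\<lambda>\<omega>. (\<xi> \<omega>, \<eta> \<omega>)) \<in> measurable M (count_space UNIV \<Otimes>\<^sub>M count_space UNIV)"
    using \<xi>_rv \<eta>_rv by (rule measurable_Pair)
  then show ?thesis by (simp add: pair_measure_countable)
qed

lemma copies_rv:
  assumes "k \<ge> 1" shows "(\<lambda>\<omega>. (\<xi>s k \<omega>, \<eta>s k \<omega>)) \<in> measurable M (count_space UNIV)"
  using copies_indep assms unfolding indep_vars_def by auto

lemma copies_fun_rv:
  fixes g :: "nat \<times> nat \<Rightarrow> real"
  assumes "k \<ge> 1" shows "(\<lambda>\<omega>. g (\<xi>s k \<omega>, \<eta>s k \<omega>)) \<in> borel_measurable M"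
  by (rule measurable_compose[OF copies_rv[OF assms]]) simp

lemma generic_fun_rv:
  fixes g :: "nat \<times> nat \<Rightarrow> real"
  shows "(\<lambda>\<omega>. g (\<xi> \<omega>, \<eta> \<omega>)) \<in> borel_measurable M"
  by (rule measurable_compose[OF pair_rv]) simp

lemma copies_fun_distr:
  fixes g :: "nat \<times> nat \<Rightarrow> real"
  assumes "k \<ge> 1"
  shows "distr M borel (\<lambda>\<omega>. g (\<xi>s k \<omega>, \<eta>s k \<omega>)) = distr M borel (\<lambda>\<omega>. g (\<xi> \<omega>, \<eta> \<omega>))"
proof -
  have g: "g \<in> measurable (count_space UNIV) borel" by simp
  have "distr M borel (\<lambda>\<omega>. g (\<xi>s k \<omega>, \<eta>s k \<omega>)) =
      distr (distr M (count_space UNIV) (\<lambda>\<omega>. (\<xi>s k \<omega>, \<eta>s k \<omega>))) borel g"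
    unfolding distr_distr[OF g copies_rv[OF assms]] comp_def ..
  also have "\<dots> = distr M borel (\<lambda>\<omega>. g (\<xi> \<omega>, \<eta> \<omega>))"
    unfolding copies_distr[OF assms] distr_distr[OF g pair_rv] comp_def ..
  finally show ?thesis .
qed

lemma copies_fun_expectation:
  fixes g :: "nat \<times> nat \<Rightarrow> real"
  assumes "k \<ge> 1"
  shows "expectation (\<lambda>\<omega>. g (\<xi>s k \<omega>, \<eta>s k \<omega>)) = expectation (\<lambda>\<omega>. g (\<xi> \<omega>, \<eta> \<omega>))"
proof -
  have "(\<integral>x. x \<partial>distr M borel (\<lambda>\<omega>. g (\<xi>s k \<omega>, \<eta>s k \<omega>))) = (\<integral>x. x \<partial>distr M borel (\<lambda>\<omega>. g (\<xi> \<omega>, \<eta> \<omega>)))"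
    by (simp only: copies_fun_distr[OF assms, of g])
  then show ?thesis
    using copies_fun_rv[OF assms, of g] generic_fun_rv[of g] by (simp add: integral_distr)
qed

lemma copies_fun_integrable:
  fixes g :: "nat \<times> nat \<Rightarrow> real"
  assumes "k \<ge> 1" "integrable M (\<lambda>\<omega>. g (\<xi> \<omega>, \<eta> \<omega>))"
  shows "integrable M (\<lambda>\<omega>. g (\<xi>s k \<omega>, \<eta>s k \<omega>))"
proof -
  have "integrable (distr M borel (\<lambda>\<omega>. g (\<xi> \<omega>, \<eta> \<omega>))) (\<lambda>x. x)"
    using assms(2) generic_fun_rv[of g] by (simp add: integrable_distr_eq)
  then have "integrable (distr M borel (\<lambda>\<omega>. g (\<xi>s k \<omega>, \<eta>s k \<omega>))) (\<lambda>x. x)"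
    by (simp only: copies_fun_distr[OF assms(1), of g])
  then show ?thesis using copies_fun_rv[OF assms(1), of g] by (simp add: integrable_distr_eq)
qed

lemma copies_fun_prob_gt:
  fixes g :: "nat \<times> nat \<Rightarrow> real"
  assumes "k \<ge> 1"
  shows "prob {\<omega> \<in> space M. g (\<xi>s k \<omega>, \<eta>s k \<omega>) > x} = prob {\<omega> \<in> space M. g (\<xi> \<omega>, \<eta> \<omega>) > x}"
proof -
  have "measure (distr M borel (\<lambda>\<omega>. g (\<xi>s k \<omega>, \<eta>s k \<omega>))) {x<..} = measure (distr M borel (\<lambda>\<omega>. g (\<xi> \<omega>, \<eta> \<omega>))) {x<..}"
    by (simp only: copies_fun_distr[OF assms, of g])
  moreover have "(\<lambda>\<omega>. h \<omega>) -` {x<..} \<inter> space M = {\<omega> \<in> space M. h \<omega> > x}" for h :: "'a \<Rightarrow> real"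
    by auto
  ultimately show ?thesis
    using copies_fun_rv[OF assms, of g] generic_fun_rv[of g] by (simp add: measure_distr)
qed

lemma copies_fun_indep:
  fixes h :: "nat \<Rightarrow> nat \<times> nat \<Rightarrow> real"
  assumes "I \<subseteq> {1..}"
  shows "indep_vars (\<lambda>_. borel) (\<lambda>k \<omega>. h k (\<xi>s k \<omega>, \<eta>s k \<omega>)) I"
  using indep_vars_subset[OF copies_indep assms] by (rule indep_vars_compose2) simp

lemma mult_\<xi>_sq:
  assumes "prime p"
  shows "integrable M (\<lambda>\<omega>. (real (multiplicity p (\<xi> \<omega>)))\<^sup>2)"
proof (rule Bochner_Integration.integrable_bound)
  show "integrable M (\<lambda>\<omega>. (ln (real (\<xi> \<omega>)))\<^sup>2 / (ln 2)\<^sup>2)" using ln_\<xi>_sq by simp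
  show "(\<lambda>\<omega>. (real (multiplicity p (\<xi> \<omega>)))\<^sup>2) \<in> borel_measurable M"
    using generic_fun_rv[of "\<lambda>(x, y). (real (multiplicity p x))\<^sup>2"] by simp
  show "AE \<omega> in M. norm ((real (multiplicity p (\<xi> \<omega>)))\<^sup>2) \<le> norm ((ln (real (\<xi> \<omega>)))\<^sup>2 / (ln 2)\<^sup>2)"
  proof (rule AE_I2)
    fix \<omega> assume "\<omega> \<in> space M"
    then have "real (multiplicity p (\<xi> \<omega>)) * ln 2 \<le> ln (real (\<xi> \<omega>))"
      using generic_pos by (intro multiplicity_mult_ln_le assms) auto
    then have "real (multiplicity p (\<xi> \<omega>)) \<le> ln (real (\<xi> \<omega>)) / ln 2"
      by (simp add: le_divide_eq)
    then have "(real (multiplicity p (\<xi> \<omega>)))\<^sup>2 \<le> (ln (real (\<xi> \<omega>)) / ln 2)\<^sup>2"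
      by (rule power_mono) simp
    then show "norm ((real (multiplicity p (\<xi> \<omega>)))\<^sup>2) \<le> norm ((ln (real (\<xi> \<omega>)))\<^sup>2 / (ln 2)\<^sup>2)"
      by (simp add: power_divide)
  qed
qed

lemma mult_\<xi>_integrable:
  assumes "prime p"
  shows "integrable M (\<lambda>\<omega>. real (multiplicity p (\<xi> \<omega>)))"
proof (rule square_integrable_imp_integrable[OF _ mult_\<xi>_sq[OF assms]])
  show "(\<lambda>\<omega>. real (multiplicity p (\<xi> \<omega>))) \<in> borel_measurable M"
    using generic_fun_rv[of "\<lambda>(x, y). real (multiplicity p x)"] by simp
qed

lemma T_mult_eq:
  assumes "prime p" "k \<ge> 1" "\<omega> \<in> space M"
  shows "T_mult \<xi>s \<eta>s p k \<omega> = (\<Sum>j\<in>{1..k - 1}. multiplicity p (\<xi>s j \<omega>)) + multiplicity p (\<eta>s k \<omega>)"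
proof -
  have nz: "\<xi>s j \<omega> \<noteq> 0" if "j \<in> {1..k - 1}" for j
    using copies_pos[of j \<omega>] that assms(3) by auto
  have "\<eta>s k \<omega> \<noteq> 0" using copies_pos[of k \<omega>] assms by auto
  moreover have "(\<Prod>j = 1..k - 1. \<xi>s j \<omega>) \<noteq> 0" using nz by simp
  moreover have "multiplicity p (\<Prod>j = 1..k - 1. \<xi>s j \<omega>) = (\<Sum>j = 1..k - 1. multiplicity p (\<xi>s j \<omega>))"
    using nz by (intro multiplicity_prod_nat[OF \<open>prime p\<close>]) auto
  ultimately show ?thesis
    unfolding T_mult_def Theta_prod_def Pi_prod_def
    by (subst prime_elem_multiplicity_mult_distrib) (use \<open>prime p\<close> in auto)
qed

lemma T_mult_rv:
  assumes "prime p" "k \<ge> 1"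
  shows "(\<lambda>\<omega>. real (T_mult \<xi>s \<eta>s p k \<omega>)) \<in> borel_measurable M"
proof -
  have "(\<lambda>\<omega>. (\<Sum>j\<in>{1..k - 1}. real (multiplicity p (\<xi>s j \<omega>))) + real (multiplicity p (\<eta>s k \<omega>)))
      \<in> borel_measurable M"
    using copies_fun_rv[of _ "\<lambda>(x, y). real (multiplicity p x)"]
      copies_fun_rv[OF assms(2), of "\<lambda>(x, y). real (multiplicity p y)"]
    by (intro borel_measurable_add borel_measurable_sum) auto
  then show ?thesis
    by (rule measurable_cong[THEN iffD1, rotated]) (simp add: T_mult_eq[OF assms])
qed

lemma max_T_rv:
  assumes "prime p"
  shows "(\<lambda>\<omega>. real (max_T \<xi>s \<eta>s p m \<omega>)) \<in> borel_measurable M"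
proof (cases "m = 0")
  case False
  have "(\<lambda>\<omega>. Max ((\<lambda>k. real (T_mult \<xi>s \<eta>s p k \<omega>)) ` {1..m})) \<in> borel_measurable M"
    using T_mult_rv[OF assms] by (intro borel_measurable_Max) auto
  moreover have "Max ((\<lambda>k. real (T_mult \<xi>s \<eta>s p k \<omega>)) ` {1..m}) = real (max_T \<xi>s \<eta>s p m \<omega>)" for \<omega>
  proof -
    have "real (Max ((\<lambda>k. T_mult \<xi>s \<eta>s p k \<omega>) ` {1..m})) =
        Max (real ` ((\<lambda>k. T_mult \<xi>s \<eta>s p k \<omega>) ` {1..m}))"
      using False by (intro mono_Max_commute) (auto simp: mono_def)
    then show ?thesis using False by (simp add: max_T_def image_image)
  qed
  ultimately show ?thesis by simp
qed (simp add: max_T_def)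

section \<open>The running maximum stays near the walk\<close>

definition walk :: "nat \<Rightarrow> nat \<Rightarrow> 'a \<Rightarrow> real" where
  "walk p m \<omega> = (\<Sum>k\<in>{1..m}. real (multiplicity p (\<xi>s k \<omega>)))"

lemma walk_rv: "walk p m \<in> borel_measurable M"
  unfolding walk_def
  using copies_fun_rv[of _ "\<lambda>(x, y). real (multiplicity p x)"]
  by (intro borel_measurable_sum) auto

text \<open>If the maximum, attained at \<open>k\<close>, is far above \<open>S\<^sub>m\<close>, then \<open>\<lambda>\<^sub>p(\<eta>\<^sub>k)\<close> exceeds the gain of the walk after
time \<open>k\<close>. It cannot be far below, because \<open>T\<^sub>m \<ge> S\<^sub>m\<^sub>-\<^sub>1\<close>, unless the last step is large.\<close>

lemma max_T_minus_walk_cases: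
  assumes "prime p" "\<omega> \<in> space M" "0 \<le> L" and gt: "\<bar>real (max_T \<xi>s \<eta>s p m \<omega>) - walk p m \<omega>\<bar> > L"
  shows "m \<ge> 1 \<and> (real (multiplicity p (\<xi>s m \<omega>)) > L \<or>
    (\<exists>k\<in>{1..m}. real (multiplicity p (\<eta>s k \<omega>)) - (\<Sum>i\<in>{k<..m}. real (multiplicity p (\<xi>s i \<omega>))) > L))"
proof -
  have m: "m \<ge> 1"
  proof (rule ccontr)
    assume "\<not> ?thesis"
    then show False using gt \<open>0 \<le> L\<close> by (simp add: max_T_def walk_def)
  qed
  let ?T = "\<lambda>k. T_mult \<xi>s \<eta>s p k \<omega>" and ?X = "\<lambda>k. real (multiplicity p (\<xi>s k \<omega>))"
    and ?Y = "\<lambda>k. real (multiplicity p (\<eta>s k \<omega>))"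
  have T: "real (?T k) = (\<Sum>j\<in>{1..k - 1}. ?X j) + ?Y k" if "k \<ge> 1" for k
    using T_mult_eq[OF assms(1) that assms(2)] by simp
  have max: "max_T \<xi>s \<eta>s p m \<omega> = Max (?T ` {1..m})" using m by (simp add: max_T_def)
  have split: "walk p m \<omega> = (\<Sum>j\<in>{1..k - 1}. ?X j) + ?X k + (\<Sum>i\<in>{k<..m}. ?X i)" if "k \<in> {1..m}" for k
  proof -
    have eq: "{1..m} = insert k ({1..k - 1} \<union> {k<..m})" using that by auto
    have "k \<notin> {1..k - 1} \<union> {k<..m}" using that by auto
    then have "walk p m \<omega> = ?X k + (\<Sum>i\<in>{1..k - 1} \<union> {k<..m}. ?X i)"
      unfolding walk_def eq by (intro sum.insert) auto
    also have "(\<Sum>i\<in>{1..k - 1} \<union> {k<..m}. ?X i) = (\<Sum>j\<in>{1..k - 1}. ?X j) + (\<Sum>i\<in>{k<..m}. ?X i)"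
      by (intro sum.union_disjoint) auto
    finally show ?thesis by simp
  qed
  consider "real (max_T \<xi>s \<eta>s p m \<omega>) - walk p m \<omega> > L" | "walk p m \<omega> - real (max_T \<xi>s \<eta>s p m \<omega>) > L"
    using gt by linarith
  then show ?thesis
  proof cases
    case 1
    have "Max (?T ` {1..m}) \<in> ?T ` {1..m}" using m by (intro Max_in) auto
    then obtain k where k: "k \<in> {1..m}" "max_T \<xi>s \<eta>s p m \<omega> = ?T k" using max by auto
    have "?Y k - (\<Sum>i\<in>{k<..m}. ?X i) > L"
      using 1 T[of k] split[OF k(1)] k by simp
    then show ?thesis using m k(1) by auto
  next
    case 2
    have "?T m \<le> max_T \<xi>s \<eta>s p m \<omega>" unfolding max using m by (intro Max_ge) auto
    then have "real (?T m) \<le> real (max_T \<xi>s \<eta>s p m \<omega>)" by simp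
    then have "?X m > L" using 2 T[OF m] split[of m] m by simp
    then show ?thesis using m by auto
  qed
qed

text \<open>This is where it matters that \<open>p\<close> divides \<open>\<xi>\<close> with positive probability: it supplies the drift.\<close>

lemma exp_minus_mult_\<xi>:
  assumes "prime p"
  shows "expectation (\<lambda>\<omega>. exp (- real (multiplicity p (\<xi> \<omega>)))) < 1"
proof -
  let ?D = "{\<omega> \<in> space M. p dvd \<xi> \<omega>}"
  have rv: "(\<lambda>\<omega>. exp (- real (multiplicity p (\<xi> \<omega>)))) \<in> borel_measurable M"
    using generic_fun_rv[of "\<lambda>(x, y). exp (- real (multiplicity p x))"] by simp
  have D: "?D \<in> events" using dvd_\<xi>[OF assms] measure_notin_sets[of ?D M] by force
  have "expectation (\<lambda>\<omega>. exp (- real (multiplicity p (\<xi> \<omega>)))) \<le>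
      expectation (\<lambda>\<omega>. 1 - (1 - exp (- 1)) * indicator ?D \<omega>)"
  proof (rule integral_mono)
    show "integrable M (\<lambda>\<omega>. exp (- real (multiplicity p (\<xi> \<omega>))))"
      using rv by (intro integrable_const_bound[where B=1]) auto
    show "integrable M (\<lambda>\<omega>. 1 - (1 - exp (- 1)) * indicator ?D \<omega> :: real)"
      using D by (auto simp: emeasure_eq_measure)
    fix \<omega> assume \<omega>: "\<omega> \<in> space M"
    show "exp (- real (multiplicity p (\<xi> \<omega>))) \<le> 1 - (1 - exp (- 1)) * indicator ?D \<omega>"
    proof (cases "p dvd \<xi> \<omega>")
      case True
      have "multiplicity p (\<xi> \<omega>) > 0"
        using True generic_pos[OF \<omega>] assms by (subst prime_multiplicity_gt_zero_iff) auto
      then show ?thesis using True \<omega> by simp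
    qed simp
  qed
  also have "\<dots> = 1 - (1 - exp (- 1)) * prob ?D"
    using D by (simp add: prob_space emeasure_eq_measure)
  also have "\<dots> < 1" using dvd_\<xi>[OF assms] by simp
  finally show ?thesis .
qed

text \<open>The bound is uniform in \<open>m\<close> because the constants come from the common law of the copies.\<close>

lemma max_T_minus_walk_tight:
  assumes p: "prime p" and e: "0 < e"
  obtains L where "0 \<le> L" "\<And>m. prob {\<omega> \<in> space M. \<bar>real (max_T \<xi>s \<eta>s p m \<omega>) - walk p m \<omega>\<bar> > L} \<le> e"
proof -
  let ?X = "\<lambda>k \<omega>. real (multiplicity p (\<xi>s k \<omega>))" and ?Y = "\<lambda>k \<omega>. real (multiplicity p (\<eta>s k \<omega>))"
  let ?gX = "\<lambda>\<omega>. real (multiplicity p (\<xi> \<omega>))" and ?gY = "\<lambda>\<omega>. real (multiplicity p (\<eta> \<omega>))"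
  have X [measurable]: "?X k \<in> borel_measurable M" if "1 \<le> k" for k
    using copies_fun_rv[OF that, of "\<lambda>(x, y). real (multiplicity p x)"] by simp
  have Y [measurable]: "?Y k \<in> borel_measurable M" if "1 \<le> k" for k
    using copies_fun_rv[OF that, of "\<lambda>(x, y). real (multiplicity p y)"] by simp
  obtain L1 where L1: "0 \<le> L1"
    "\<And>m. prob {\<omega> \<in> space M. \<exists>k\<in>{1..m}. ?Y k \<omega> - (\<Sum>i\<in>{k<..m}. ?X i \<omega>) > L1} \<le> e / 2"
  proof (rule perturbed_walk_tight[where e = "e / 2" and X = ?X and Y = ?Y and ?Y0.0 = ?gY])
    show "indep_vars (\<lambda>_. borel) ?X {1..}"
      using copies_fun_indep[of "{1..}" "\<lambda>_ (x, y). real (multiplicity p x)"] by simp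
    show "expectation (\<lambda>\<omega>. exp (- ?X k \<omega>)) \<le> expectation (\<lambda>\<omega>. exp (- ?gX \<omega>))" if "1 \<le> k" for k
      using copies_fun_expectation[OF that, of "\<lambda>(x, y). exp (- real (multiplicity p x))"] by simp
    show "prob {\<omega> \<in> space M. ?Y k \<omega> > x} = prob {\<omega> \<in> space M. ?gY \<omega> > x}" if "1 \<le> k" for k x
      using copies_fun_prob_gt[OF that, of x "\<lambda>(x, y). real (multiplicity p y)"] by simp
  qed (use exp_minus_mult_\<xi>[OF p] mult_\<eta>[OF p] e Y in auto)
  obtain L2 where L2: "prob {\<omega> \<in> space M. \<bar>?gX \<omega>\<bar> > L2} \<le> e / 2"
    using tight_single[of ?gX "e / 2"] mult_\<xi>_integrable[OF p] e by auto
  define L where "L = max L1 L2"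
  show ?thesis
  proof
    show "0 \<le> L" using L1 by (simp add: L_def)
    fix m
    let ?B = "{\<omega> \<in> space M. \<bar>real (max_T \<xi>s \<eta>s p m \<omega>) - walk p m \<omega>\<bar> > L}"
    let ?P = "{\<omega> \<in> space M. \<exists>k\<in>{1..m}. ?Y k \<omega> - (\<Sum>i\<in>{k<..m}. ?X i \<omega>) > L1}"
    let ?Q = "{\<omega> \<in> space M. ?X m \<omega> > L2}"
    have P: "?P \<in> events"
    proof -
      have "?P = (\<Union>k\<in>{1..m}. {\<omega> \<in> space M. ?Y k \<omega> - (\<Sum>i\<in>{k<..m}. ?X i \<omega>) > L1})" by auto
      also have "\<dots> \<in> events"
      proof (rule sets.finite_UN)
        fix k assume "k \<in> {1..m}"
        then have [measurable]: "(\<lambda>\<omega>. ?Y k \<omega> - (\<Sum>i\<in>{k<..m}. ?X i \<omega>)) \<in> borel_measurable M"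
          by (intro borel_measurable_diff borel_measurable_sum X Y) auto
        show "{\<omega> \<in> space M. ?Y k \<omega> - (\<Sum>i\<in>{k<..m}. ?X i \<omega>) > L1} \<in> events" by measurable
      qed simp
      finally show ?thesis .
    qed
    show "prob ?B \<le> e"
    proof (cases "m \<ge> 1")
      case False
      then have "?B = {}" using max_T_minus_walk_cases[OF p _ \<open>0 \<le> L\<close>] by auto
      then have "prob ?B = 0" by (simp only: measure_empty)
      then show ?thesis using e by linarith
    next
      case True
      have Q: "?Q \<in> events" using X[OF True] by measurable
      have "?B \<subseteq> ?P \<union> ?Q"
      proof
        fix \<omega> assume "\<omega> \<in> ?B"
        then have \<omega>: "\<omega> \<in> space M" "\<bar>real (max_T \<xi>s \<eta>s p m \<omega>) - walk p m \<omega>\<bar> > L" by auto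
        show "\<omega> \<in> ?P \<union> ?Q"
          using max_T_minus_walk_cases[OF p \<omega>(1) \<open>0 \<le> L\<close> \<omega>(2)]
        proof (elim conjE disjE bexE)
          assume "L < ?X m \<omega>"
          then show ?thesis using \<omega>(1) by (auto simp: L_def)
        next
          fix k assume "k \<in> {1..m}" "L < ?Y k \<omega> - (\<Sum>i\<in>{k<..m}. ?X i \<omega>)"
          then show ?thesis using \<omega>(1) by (auto simp: L_def)
        qed
      qed
      then have "prob ?B \<le> prob (?P \<union> ?Q)"
        using P Q by (intro finite_measure_mono) auto
      also have "\<dots> \<le> prob ?P + prob ?Q" using P Q by (intro measure_Un_le) auto
      also have "prob ?Q = prob {\<omega> \<in> space M. ?gX \<omega> > L2}"
        using copies_fun_prob_gt[OF True, of L2 "\<lambda>(x, y). real (multiplicity p x)"] by simp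
      finally show ?thesis using L1(2)[of m] L2 by simp
    qed
  qed
qed

section \<open>The rescaled walk\<close>

text \<open>Centred by the mean of the steps actually taken, not by \<open>\<mu> q * (t * u)\<close>: this makes its increments
over a time grid exact sums of independent centred steps and its value at time \<open>0\<close> equal to \<open>0\<close>.\<close>

definition rescaled_walk :: "real \<Rightarrow> real \<Rightarrow> nat \<Rightarrow> 'a \<Rightarrow> real" where
  "rescaled_walk t u q \<omega> = (walk q (nat \<lfloor>t * u\<rfloor>) \<omega> - \<mu> q * real (nat \<lfloor>t * u\<rfloor>)) / sqrt t"

lemma rescaled_walk_rv: "rescaled_walk t u q \<in> borel_measurable M"
proof -
  have "(\<lambda>\<omega>. (walk q (nat \<lfloor>t * u\<rfloor>) \<omega> - \<mu> q * real (nat \<lfloor>t * u\<rfloor>)) / sqrt t) \<in> borel_measurable M"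
    by (intro borel_measurable_divide borel_measurable_diff walk_rv) auto
  then show ?thesis unfolding rescaled_walk_def[abs_def] .
qed

lemma centered_mult:
  assumes "prime q"
  shows "integrable M (\<lambda>\<omega>. real (multiplicity q (\<xi> \<omega>)) - \<mu> q)"
    and "expectation (\<lambda>\<omega>. real (multiplicity q (\<xi> \<omega>)) - \<mu> q) = 0"
    and "integrable M (\<lambda>\<omega>. (real (multiplicity q (\<xi> \<omega>)) - \<mu> q)\<^sup>2)"
proof -
  show "integrable M (\<lambda>\<omega>. real (multiplicity q (\<xi> \<omega>)) - \<mu> q)"
    using mult_\<xi>_integrable[OF assms] by simp
  show "expectation (\<lambda>\<omega>. real (multiplicity q (\<xi> \<omega>)) - \<mu> q) = 0"
    using mult_\<xi>_integrable[OF assms] by (simp add: prob_space)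
  show "integrable M (\<lambda>\<omega>. (real (multiplicity q (\<xi> \<omega>)) - \<mu> q)\<^sup>2)"
    using mult_\<xi>_integrable[OF assms] mult_\<xi>_sq[OF assms] by (simp add: power2_diff)
qed

lemma walk_centered: "walk q m \<omega> - \<mu> q * real m = (\<Sum>k\<in>{1..m}. real (multiplicity q (\<xi>s k \<omega>)) - \<mu> q)"
  by (simp add: walk_def sum_subtractf mult.commute)

text \<open>Chebyshev's inequality for the centred walk.\<close>

lemma walk_tail:
  assumes q: "prime q" and a: "0 < a"
  shows "prob {\<omega> \<in> space M. \<bar>walk q m \<omega> - \<mu> q * real m\<bar> \<ge> a}
    \<le> real m * expectation (\<lambda>\<omega>. (real (multiplicity q (\<xi> \<omega>)) - \<mu> q)\<^sup>2) / a\<^sup>2"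
proof -
  let ?Z = "\<lambda>k \<omega>. real (multiplicity q (\<xi>s k \<omega>)) - \<mu> q"
  let ?v = "expectation (\<lambda>\<omega>. (real (multiplicity q (\<xi> \<omega>)) - \<mu> q)\<^sup>2)"
  have Zi: "integrable M (\<lambda>\<omega>. (?Z k \<omega>)\<^sup>2)" if "k \<in> {1..m}" for k
    using copies_fun_integrable[of k "\<lambda>(x, y). (real (multiplicity q x) - \<mu> q)\<^sup>2"] centered_mult(3)[OF q] that
    by simp
  have Zv: "expectation (\<lambda>\<omega>. (?Z k \<omega>)\<^sup>2) = ?v" if "k \<in> {1..m}" for k
    using copies_fun_expectation[of k "\<lambda>(x, y). (real (multiplicity q x) - \<mu> q)\<^sup>2"] that by simp
  have Z0: "expectation (?Z k) = 0" if "k \<in> {1..m}" for k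
  proof -
    have "expectation (?Z k) = expectation (\<lambda>\<omega>. real (multiplicity q (\<xi> \<omega>)) - \<mu> q)"
      using copies_fun_expectation[of k "\<lambda>(x, y). real (multiplicity q x) - \<mu> q"] that by simp
    then show ?thesis using centered_mult(2)[OF q] by (rule trans)
  qed
  have ind: "indep_vars (\<lambda>_. borel) ?Z {1..m}"
    using copies_fun_indep[of "{1..m}" "\<lambda>_ (x, y). real (multiplicity q x) - \<mu> q"] by auto
  have m2: "integrable M (\<lambda>\<omega>. (\<Sum>k\<in>{1..m}. ?Z k \<omega>)\<^sup>2) \<and>
      expectation (\<lambda>\<omega>. (\<Sum>k\<in>{1..m}. ?Z k \<omega>)\<^sup>2) = (\<Sum>k\<in>{1..m}. expectation (\<lambda>\<omega>. (?Z k \<omega>)\<^sup>2))"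
    by (rule second_moment_sum_indep[OF _ ind Zi Z0]) auto
  also have "(\<Sum>k\<in>{1..m}. expectation (\<lambda>\<omega>. (?Z k \<omega>)\<^sup>2)) = (\<Sum>k\<in>{1..m}. ?v)"
    by (intro sum.cong refl Zv)
  finally have E: "integrable M (\<lambda>\<omega>. (\<Sum>k\<in>{1..m}. ?Z k \<omega>)\<^sup>2)"
    "expectation (\<lambda>\<omega>. (\<Sum>k\<in>{1..m}. ?Z k \<omega>)\<^sup>2) = real m * ?v" by simp_all
  have "{\<omega> \<in> space M. \<bar>walk q m \<omega> - \<mu> q * real m\<bar> \<ge> a} = {\<omega> \<in> space M. (\<Sum>k\<in>{1..m}. ?Z k \<omega>)\<^sup>2 \<ge> a\<^sup>2}"
    unfolding walk_centered using a by (auto simp: abs_le_square_iff[symmetric])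
  also have "prob \<dots> \<le> expectation (\<lambda>\<omega>. (\<Sum>k\<in>{1..m}. ?Z k \<omega>)\<^sup>2) / a\<^sup>2"
    using a by (intro integral_Markov_inequality_measure[OF E(1), where A = "{}"]) auto
  finally show ?thesis unfolding E(2) .
qed

lemma rescaled_walk_tight:
  assumes q: "prime q" and u: "0 \<le> u" and e: "0 < e"
  shows "\<exists>K. \<forall>\<^sub>F t in at_top. prob {\<omega> \<in> space M. \<bar>rescaled_walk t u q \<omega>\<bar> > K} \<le> e"
proof -
  let ?v = "expectation (\<lambda>\<omega>. (real (multiplicity q (\<xi> \<omega>)) - \<mu> q)\<^sup>2)"
  have v: "0 \<le> ?v" by (intro integral_nonneg_AE) auto
  define K where "K = sqrt (u * ?v / e) + 1"
  have uv: "0 \<le> u * ?v / e" using u v e by simp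
  have K: "0 < K" using uv unfolding K_def by (intro add_nonneg_pos) auto
  have K2: "u * ?v / K\<^sup>2 \<le> e"
  proof -
    have "u * ?v / e = (sqrt (u * ?v / e))\<^sup>2" using uv by simp
    also have "\<dots> \<le> K\<^sup>2" unfolding K_def using uv by (intro power_mono) auto
    finally show ?thesis using e K by (simp add: field_simps)
  qed
  have "\<forall>\<^sub>F t in at_top. prob {\<omega> \<in> space M. \<bar>rescaled_walk t u q \<omega>\<bar> > K} \<le> e"
    using eventually_gt_at_top[of 0]
  proof eventually_elim
    case (elim t)
    let ?m = "nat \<lfloor>t * u\<rfloor>"
    have "0 \<le> t * u" using elim u by simp
    then have m: "real ?m \<le> t * u" by linarith
    have st: "0 < sqrt t" using elim by simp
    have "prob {\<omega> \<in> space M. \<bar>rescaled_walk t u q \<omega>\<bar> > K} \<le>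
        prob {\<omega> \<in> space M. \<bar>walk q ?m \<omega> - \<mu> q * real ?m\<bar> \<ge> K * sqrt t}"
    proof (rule finite_measure_mono)
      show "{\<omega> \<in> space M. \<bar>rescaled_walk t u q \<omega>\<bar> > K} \<subseteq> {\<omega> \<in> space M. \<bar>walk q ?m \<omega> - \<mu> q * real ?m\<bar> \<ge> K * sqrt t}"
        using st by (auto simp: rescaled_walk_def less_divide_eq)
      have [measurable]: "walk q ?m \<in> borel_measurable M" by (rule walk_rv)
      show "{\<omega> \<in> space M. \<bar>walk q ?m \<omega> - \<mu> q * real ?m\<bar> \<ge> K * sqrt t} \<in> events" by measurable
    qed
    also have "\<dots> \<le> real ?m * ?v / (K * sqrt t)\<^sup>2"
      using K st by (intro walk_tail[OF q]) simp
    also have "\<dots> \<le> (t * u) * ?v / (K * sqrt t)\<^sup>2"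
      using m v by (intro divide_right_mono mult_right_mono) auto
    also have "\<dots> = u * ?v / K\<^sup>2"
      using elim by (simp add: power_mult_distrib)
    finally show ?case using K2 by simp
  qed
  then show ?thesis by blast
qed

text \<open>The maximum is within a tight distance of the walk, and replacing \<open>t u\<close> by its integer part costs
at most \<open>\<mu> q\<close>; both are negligible against \<open>sqrt t\<close>.\<close>

lemma max_T_close_rescaled_walk:
  assumes q: "prime q" and u: "0 \<le> u" and e: "0 < e"
  shows "((\<lambda>t. prob {\<omega> \<in> space M.
      \<bar>(real (max_T \<xi>s \<eta>s q (nat \<lfloor>t * u\<rfloor>) \<omega>) - \<mu> q * (t * u)) / sqrt t - rescaled_walk t u q \<omega>\<bar> > e}) \<longlongrightarrow> 0) at_top"
proof (rule tendstoI)
  fix d :: real assume "0 < d"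
  then obtain L where L: "0 \<le> L"
    "\<And>m. prob {\<omega> \<in> space M. \<bar>real (max_T \<xi>s \<eta>s q m \<omega>) - walk q m \<omega>\<bar> > L} \<le> d / 2"
    using max_T_minus_walk_tight[OF q, of "d / 2"] by auto
  have "\<forall>\<^sub>F t in at_top. (L + \<bar>\<mu> q\<bar>) / e \<le> sqrt t"
    using sqrt_at_top by (simp add: filterlim_at_top)
  with eventually_gt_at_top[of 0]
  show "\<forall>\<^sub>F t in at_top. dist (prob {\<omega> \<in> space M.
      \<bar>(real (max_T \<xi>s \<eta>s q (nat \<lfloor>t * u\<rfloor>) \<omega>) - \<mu> q * (t * u)) / sqrt t - rescaled_walk t u q \<omega>\<bar> > e}) 0 < d"
  proof eventually_elim
    case (elim t)
    let ?m = "nat \<lfloor>t * u\<rfloor>"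
    have "0 \<le> t * u" using elim u by simp
    then have m: "\<bar>real ?m - t * u\<bar> \<le> 1" by linarith
    have st: "0 < sqrt t" using elim by simp
    have Le: "L + \<bar>\<mu> q\<bar> \<le> e * sqrt t" using elim(2) e by (simp add: divide_le_eq mult.commute)
    have "prob {\<omega> \<in> space M. \<bar>(real (max_T \<xi>s \<eta>s q ?m \<omega>) - \<mu> q * (t * u)) / sqrt t - rescaled_walk t u q \<omega>\<bar> > e} \<le>
        prob {\<omega> \<in> space M. \<bar>real (max_T \<xi>s \<eta>s q ?m \<omega>) - walk q ?m \<omega>\<bar> > L}"
    proof (rule finite_measure_mono)
      show "{\<omega> \<in> space M. \<bar>(real (max_T \<xi>s \<eta>s q ?m \<omega>) - \<mu> q * (t * u)) / sqrt t - rescaled_walk t u q \<omega>\<bar> > e} \<subseteq>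
          {\<omega> \<in> space M. \<bar>real (max_T \<xi>s \<eta>s q ?m \<omega>) - walk q ?m \<omega>\<bar> > L}"
      proof safe
        fix \<omega>
        let ?D = "real (max_T \<xi>s \<eta>s q ?m \<omega>) - walk q ?m \<omega>"
        assume gt: "e < \<bar>(real (max_T \<xi>s \<eta>s q ?m \<omega>) - \<mu> q * (t * u)) / sqrt t - rescaled_walk t u q \<omega>\<bar>"
        have "(real (max_T \<xi>s \<eta>s q ?m \<omega>) - \<mu> q * (t * u)) / sqrt t - rescaled_walk t u q \<omega> =
            (?D + \<mu> q * (real ?m - t * u)) / sqrt t"
          unfolding rescaled_walk_def diff_divide_distrib[symmetric] by (simp add: algebra_simps)
        then have "e * sqrt t < \<bar>?D + \<mu> q * (real ?m - t * u)\<bar>"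
          using gt st by (simp add: less_divide_eq)
        also have "\<dots> \<le> \<bar>?D\<bar> + \<bar>\<mu> q\<bar> * \<bar>real ?m - t * u\<bar>"
          unfolding abs_mult[symmetric] by (rule abs_triangle_ineq)
        also have "\<dots> \<le> \<bar>?D\<bar> + \<bar>\<mu> q\<bar> * 1"
          using m by (intro add_left_mono mult_left_mono) auto
        finally show "L < \<bar>?D\<bar>" using Le by simp
      qed
      have [measurable]: "walk q ?m \<in> borel_measurable M" by (rule walk_rv)
      have [measurable]: "(\<lambda>\<omega>. real (max_T \<xi>s \<eta>s q ?m \<omega>)) \<in> borel_measurable M"
        by (rule max_T_rv[OF q])
      show "{\<omega> \<in> space M. \<bar>real (max_T \<xi>s \<eta>s q ?m \<omega>) - walk q ?m \<omega>\<bar> > L} \<in> events" by measurable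
    qed
    also have "\<dots> \<le> d / 2" by (rule L(2))
    finally show ?case using \<open>0 < d\<close> by (simp add: dist_real_def)
  qed
qed

section \<open>Convergence of characteristic functions\<close>

text \<open>The contribution of one step of the walk to a linear combination of centred coordinates.\<close>

definition combination :: "nat set \<Rightarrow> (nat \<Rightarrow> nat) \<Rightarrow> (nat \<Rightarrow> real) \<Rightarrow> nat \<Rightarrow> real" where
  "combination I p A x = (\<Sum>i\<in>I. A i * (real (multiplicity (p i) x) - \<mu> (p i)))"

lemma combination_rv:
  "(\<lambda>\<omega>. combination I p A (\<xi> \<omega>)) \<in> borel_measurable M"
  using generic_fun_rv[of "\<lambda>(x, y). combination I p A x"] by simp

text \<open>The second moment is the quadratic form of the covariance matrix; in particular that form is
nonnegative on every vector.\<close>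

lemma combination_moments:
  assumes I: "finite I" and p: "\<And>i. i \<in> I \<Longrightarrow> prime (p i)"
  shows "expectation (\<lambda>\<omega>. combination I p A (\<xi> \<omega>)) = 0"
    and "integrable M (\<lambda>\<omega>. (combination I p A (\<xi> \<omega>))\<^sup>2)"
    and "expectation (\<lambda>\<omega>. (combination I p A (\<xi> \<omega>))\<^sup>2) =
      (\<Sum>i\<in>I. \<Sum>j\<in>I. A i * A j * covariance M (\<lambda>\<omega>. real (multiplicity (p i) (\<xi> \<omega>)))
                             (\<lambda>\<omega>. real (multiplicity (p j) (\<xi> \<omega>))))"
proof -
  let ?Z = "\<lambda>i \<omega>. real (multiplicity (p i) (\<xi> \<omega>)) - \<mu> (p i)"
  have "expectation (\<lambda>\<omega>. combination I p A (\<xi> \<omega>)) = (\<Sum>i\<in>I. A i * expectation (?Z i))"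
    unfolding combination_def using centered_mult(1)[OF p]
    by (subst Bochner_Integration.integral_sum) auto
  also have "\<dots> = 0" using centered_mult(2)[OF p] by (intro sum.neutral) auto
  finally show "expectation (\<lambda>\<omega>. combination I p A (\<xi> \<omega>)) = 0" .
  have prod: "integrable M (\<lambda>\<omega>. ?Z i \<omega> * ?Z j \<omega>)" if ij: "i \<in> I" "j \<in> I" for i j
  proof (rule Bochner_Integration.integrable_bound)
    show "integrable M (\<lambda>\<omega>. (?Z i \<omega>)\<^sup>2 + (?Z j \<omega>)\<^sup>2)"
      using centered_mult(3)[OF p[OF ij(1)]] centered_mult(3)[OF p[OF ij(2)]] by (rule Bochner_Integration.integrable_add)
    show "(\<lambda>\<omega>. ?Z i \<omega> * ?Z j \<omega>) \<in> borel_measurable M"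
      using generic_fun_rv[of "\<lambda>(x, y). (real (multiplicity (p i) x) - \<mu> (p i)) * (real (multiplicity (p j) x) - \<mu> (p j))"]
      by simp
    have "\<bar>x * y\<bar> \<le> x\<^sup>2 + y\<^sup>2" for x y :: real
    proof -
      have "2 * (\<bar>x\<bar> * \<bar>y\<bar>) \<le> x\<^sup>2 + y\<^sup>2" using sum_squares_bound[of "\<bar>x\<bar>" "\<bar>y\<bar>"] by simp
      then show ?thesis unfolding abs_mult using mult_nonneg_nonneg[OF abs_ge_zero[of x] abs_ge_zero[of y]] by linarith
    qed
    then show "AE \<omega> in M. norm (?Z i \<omega> * ?Z j \<omega>) \<le> norm ((?Z i \<omega>)\<^sup>2 + (?Z j \<omega>)\<^sup>2)"
      by (intro AE_I2) (simp add: abs_of_nonneg)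
  qed
  have sq: "(combination I p A (\<xi> \<omega>))\<^sup>2 = (\<Sum>i\<in>I. \<Sum>j\<in>I. A i * A j * (?Z i \<omega> * ?Z j \<omega>))" for \<omega>
    unfolding combination_def power2_eq_square sum_product by (intro sum.cong refl) (simp only: mult_ac)
  show "integrable M (\<lambda>\<omega>. (combination I p A (\<xi> \<omega>))\<^sup>2)"
    unfolding sq using prod by (intro Bochner_Integration.integrable_sum integrable_mult_right)
  have "expectation (\<lambda>\<omega>. (combination I p A (\<xi> \<omega>))\<^sup>2) =
      (\<Sum>i\<in>I. expectation (\<lambda>\<omega>. \<Sum>j\<in>I. A i * A j * (?Z i \<omega> * ?Z j \<omega>)))"
    unfolding sq using prod by (intro Bochner_Integration.integral_sum Bochner_Integration.integrable_sum integrable_mult_right)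
  also have "\<dots> = (\<Sum>i\<in>I. \<Sum>j\<in>I. expectation (\<lambda>\<omega>. A i * A j * (?Z i \<omega> * ?Z j \<omega>)))"
    using prod by (intro sum.cong refl Bochner_Integration.integral_sum integrable_mult_right)
  finally show "expectation (\<lambda>\<omega>. (combination I p A (\<xi> \<omega>))\<^sup>2) =
      (\<Sum>i\<in>I. \<Sum>j\<in>I. A i * A j * covariance M (\<lambda>\<omega>. real (multiplicity (p i) (\<xi> \<omega>)))
                             (\<lambda>\<omega>. real (multiplicity (p j) (\<xi> \<omega>))))"
    by (simp add: covariance_def)
qed

lemma rescaled_walk_increment:
  assumes "0 \<le> t" "u \<le> v"
  shows "(\<Sum>i\<in>I. A i * (rescaled_walk t v (p i) \<omega> - rescaled_walk t u (p i) \<omega>)) =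
    (\<Sum>l\<in>{nat \<lfloor>t * u\<rfloor><..nat \<lfloor>t * v\<rfloor>}. combination I p A (\<xi>s l \<omega>) / sqrt t)"
proof -
  let ?m = "nat \<lfloor>t * u\<rfloor>" and ?n = "nat \<lfloor>t * v\<rfloor>"
  have mn: "?m \<le> ?n" using assms by (intro nat_mono floor_mono mult_left_mono)
  have "rescaled_walk t v q \<omega> - rescaled_walk t u q \<omega> = (\<Sum>l\<in>{?m<..?n}. (real (multiplicity q (\<xi>s l \<omega>)) - \<mu> q) / sqrt t)" for q
  proof -
    let ?Z = "\<lambda>l. real (multiplicity q (\<xi>s l \<omega>)) - \<mu> q"
    have "{1..?n} = {1..?m} \<union> {?m<..?n}" using mn by auto
    then have "(\<Sum>l\<in>{1..?n}. ?Z l) = (\<Sum>l\<in>{1..?m}. ?Z l) + (\<Sum>l\<in>{?m<..?n}. ?Z l)"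
      by (simp only:) (intro sum.union_disjoint; auto)
    then have "(\<Sum>l\<in>{1..?n}. ?Z l) / sqrt t - (\<Sum>l\<in>{1..?m}. ?Z l) / sqrt t = (\<Sum>l\<in>{?m<..?n}. ?Z l) / sqrt t"
      by (simp add: add_divide_distrib)
    then show ?thesis unfolding rescaled_walk_def walk_centered sum_divide_distrib .
  qed
  then have "(\<Sum>i\<in>I. A i * (rescaled_walk t v (p i) \<omega> - rescaled_walk t u (p i) \<omega>)) =
      (\<Sum>i\<in>I. \<Sum>l\<in>{?m<..?n}. A i * ((real (multiplicity (p i) (\<xi>s l \<omega>)) - \<mu> (p i)) / sqrt t))"
    by (simp only: sum_distrib_left)
  also have "\<dots> = (\<Sum>l\<in>{?m<..?n}. \<Sum>i\<in>I. A i * ((real (multiplicity (p i) (\<xi>s l \<omega>)) - \<mu> (p i)) / sqrt t))"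
    by (rule sum.swap)
  also have "\<dots> = (\<Sum>l\<in>{?m<..?n}. combination I p A (\<xi>s l \<omega>) / sqrt t)"
    by (simp only: combination_def sum_divide_distrib times_divide_eq_right)
  finally show ?thesis .
qed

lemma rescaled_walk_increments_char:
  assumes t: "0 < t" and s: "\<And>k. k < m \<Longrightarrow> s k \<le> s (Suc k)" "0 \<le> s 0"
  shows "char (distr M borel (\<lambda>\<omega>. \<Sum>k<m. \<Sum>i\<in>I. A k i * (rescaled_walk t (s (Suc k)) (p i) \<omega> - rescaled_walk t (s k) (p i) \<omega>))) 1 =
    (\<Prod>k<m. char (distr M borel (\<lambda>\<omega>. combination I p (A k) (\<xi> \<omega>))) (1 / sqrt t)
        ^ (nat \<lfloor>t * s (Suc k)\<rfloor> - nat \<lfloor>t * s k\<rfloor>))"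
proof -
  let ?n = "\<lambda>k. nat \<lfloor>t * s k\<rfloor>"
  let ?B = "\<lambda>k. {?n k<..?n (Suc k)}"
  define X where "X = (\<lambda>(k, l) \<omega>. combination I p (A k) (\<xi>s l \<omega>) / sqrt t)"
  have mono: "?n j \<le> ?n k" if "j \<le> k" "k \<le> m" for j k
    using that
  proof (induction k)
    case (Suc k)
    show ?case
    proof (cases "j = Suc k")
      case False
      have "?n k \<le> ?n (Suc k)"
        using s(1)[of k] Suc.prems t by (intro nat_mono floor_mono mult_left_mono) auto
      moreover have "?n j \<le> ?n k" using Suc False by simp
      ultimately show ?thesis by simp
    qed simp
  qed simp
  have inj: "inj_on snd (Sigma {..<m} ?B)"
  proof (rule inj_onI)
    fix x y assume xy: "x \<in> Sigma {..<m} ?B" "y \<in> Sigma {..<m} ?B" and eq: "snd x = snd y"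
    have "fst x < m" "fst y < m" "snd x \<in> ?B (fst x)" "snd x \<in> ?B (fst y)"
      using xy eq by auto
    then have "\<not> fst x < fst y" "\<not> fst y < fst x"
      using mono[of "Suc (fst x)" "fst y"] mono[of "Suc (fst y)" "fst x"] by auto
    with eq show "x = y" by (simp add: prod_eq_iff)
  qed
  have sub: "snd ` Sigma {..<m} ?B \<subseteq> {1..}" by auto
  have ind0: "indep_vars (\<lambda>_. count_space UNIV) (\<lambda>x \<omega>. (\<xi>s (snd x) \<omega>, \<eta>s (snd x) \<omega>)) (Sigma {..<m} ?B)"
    by (rule indep_vars_reindex_inj[OF inj indep_vars_subset[OF copies_indep sub]])
  have ind: "indep_vars (\<lambda>_. borel) X (Sigma {..<m} ?B)"
  proof -
    have "indep_vars (\<lambda>_. borel) (\<lambda>x \<omega>. (\<lambda>y. combination I p (A (fst x)) (fst y) / sqrt t) (\<xi>s (snd x) \<omega>, \<eta>s (snd x) \<omega>)) (Sigma {..<m} ?B)"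
      using ind0 by (rule indep_vars_compose2) simp
    then show ?thesis unfolding X_def by (simp add: case_prod_unfold)
  qed
  have one: "char (distr M borel (X (k, l))) 1 =
      char (distr M borel (\<lambda>\<omega>. combination I p (A k) (\<xi> \<omega>))) (1 / sqrt t)" if "l \<in> ?B k" for k l
  proof -
    have l: "l \<ge> 1" using that by auto
    have "distr M borel (X (k, l)) = distr M borel (\<lambda>\<omega>. combination I p (A k) (\<xi> \<omega>) / sqrt t)"
      using copies_fun_distr[OF l, of "\<lambda>(x, y). combination I p (A k) x / sqrt t"] by (simp add: X_def)
    moreover have "(\<lambda>\<omega>. combination I p (A k) (\<xi> \<omega>) / sqrt t) \<in> borel_measurable M"
      using combination_rv[of I p "A k"] by (intro borel_measurable_divide) auto
    ultimately show ?thesis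
      using combination_rv[of I p "A k"] by (simp add: char_def integral_distr)
  qed
  have "(\<Sum>k<m. \<Sum>i\<in>I. A k i * (rescaled_walk t (s (Suc k)) (p i) \<omega> - rescaled_walk t (s k) (p i) \<omega>)) =
      (\<Sum>x\<in>Sigma {..<m} ?B. X x \<omega>)" for \<omega>
  proof -
    have "(\<Sum>k<m. \<Sum>i\<in>I. A k i * (rescaled_walk t (s (Suc k)) (p i) \<omega> - rescaled_walk t (s k) (p i) \<omega>)) =
        (\<Sum>k<m. \<Sum>l\<in>?B k. combination I p (A k) (\<xi>s l \<omega>) / sqrt t)"
      using t s(1) by (intro sum.cong refl rescaled_walk_increment) auto
    also have "\<dots> = (\<Sum>(k, l)\<in>Sigma {..<m} ?B. combination I p (A k) (\<xi>s l \<omega>) / sqrt t)"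
      by (rule sum.Sigma) auto
    finally show ?thesis by (simp add: X_def case_prod_unfold)
  qed
  then have "char (distr M borel (\<lambda>\<omega>. \<Sum>k<m. \<Sum>i\<in>I. A k i * (rescaled_walk t (s (Suc k)) (p i) \<omega> - rescaled_walk t (s k) (p i) \<omega>))) 1 =
      (\<Prod>x\<in>Sigma {..<m} ?B. char (distr M borel (X x)) 1)"
    by (simp only: char_distr_sum[OF ind])
  also have "\<dots> = (\<Prod>(k, l)\<in>Sigma {..<m} ?B. char (distr M borel (X (k, l))) 1)"
    by (simp add: case_prod_unfold)
  also have "\<dots> = (\<Prod>k<m. \<Prod>l\<in>?B k. char (distr M borel (X (k, l))) 1)"
    by (rule prod.Sigma[symmetric]) auto
  also have "\<dots> = (\<Prod>k<m. \<Prod>l\<in>?B k. char (distr M borel (\<lambda>\<omega>. combination I p (A k) (\<xi> \<omega>))) (1 / sqrt t))"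
    by (intro prod.cong refl one)
  finally show ?thesis by simp
qed

lemma rescaled_walk_increments_char_tendsto:
  assumes I: "finite I" and p: "\<And>i. i \<in> I \<Longrightarrow> prime (p i)"
    and s: "\<And>k. k < m \<Longrightarrow> s k \<le> s (Suc k)" "0 \<le> s 0"
  shows "((\<lambda>t. char (distr M borel (\<lambda>\<omega>. \<Sum>k<m. \<Sum>i\<in>I. A k i * (rescaled_walk t (s (Suc k)) (p i) \<omega> - rescaled_walk t (s k) (p i) \<omega>))) 1)
    \<longlongrightarrow> (\<Prod>k<m. of_real (exp (- ((s (Suc k) - s k) * expectation (\<lambda>\<omega>. (combination I p (A k) (\<xi> \<omega>))\<^sup>2) / 2))))) at_top"
proof (rule Lim_transform_eventually)
  have sn: "0 \<le> s k" if "k \<le> m" for k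
    using that
  proof (induction k)
    case (Suc k) then show ?case using s(1)[of k] by simp
  qed (use s(2) in simp)
  show "((\<lambda>t. \<Prod>k<m. char (distr M borel (\<lambda>\<omega>. combination I p (A k) (\<xi> \<omega>))) (1 / sqrt t)
        ^ (nat \<lfloor>t * s (Suc k)\<rfloor> - nat \<lfloor>t * s k\<rfloor>))
    \<longlongrightarrow> (\<Prod>k<m. of_real (exp (- ((s (Suc k) - s k) * expectation (\<lambda>\<omega>. (combination I p (A k) (\<xi> \<omega>))\<^sup>2) / 2))))) at_top"
  proof (intro tendsto_prod char_power_tendsto combination_rv combination_moments[OF I p])
    fix k assume "k \<in> {..<m}"
    then have k: "k < m" by simp
    have "((\<lambda>t. real (nat \<lfloor>t * s (Suc k)\<rfloor>) / t - real (nat \<lfloor>t * s k\<rfloor>) / t) \<longlongrightarrow> s (Suc k) - s k) at_top"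
      using sn k by (intro tendsto_diff floor_mult_over_tendsto) auto
    moreover have "\<forall>\<^sub>F t in at_top. real (nat \<lfloor>t * s (Suc k)\<rfloor>) / t - real (nat \<lfloor>t * s k\<rfloor>) / t =
        real (nat \<lfloor>t * s (Suc k)\<rfloor> - nat \<lfloor>t * s k\<rfloor>) / t"
      using eventually_gt_at_top[of 0]
    proof eventually_elim
      case (elim t)
      have "nat \<lfloor>t * s k\<rfloor> \<le> nat \<lfloor>t * s (Suc k)\<rfloor>"
        using elim s(1)[OF k] by (intro nat_mono floor_mono mult_left_mono) auto
      then show ?case by (simp add: of_nat_diff diff_divide_distrib)
    qed
    ultimately show "((\<lambda>t. real (nat \<lfloor>t * s (Suc k)\<rfloor> - nat \<lfloor>t * s k\<rfloor>) / t) \<longlongrightarrow> s (Suc k) - s k) at_top"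
      by (rule Lim_transform_eventually)
  qed
  show "\<forall>\<^sub>F t in at_top. (\<Prod>k<m. char (distr M borel (\<lambda>\<omega>. combination I p (A k) (\<xi> \<omega>))) (1 / sqrt t)
        ^ (nat \<lfloor>t * s (Suc k)\<rfloor> - nat \<lfloor>t * s k\<rfloor>)) =
      char (distr M borel (\<lambda>\<omega>. \<Sum>k<m. \<Sum>i\<in>I. A k i * (rescaled_walk t (s (Suc k)) (p i) \<omega> - rescaled_walk t (s k) (p i) \<omega>))) 1"
    using eventually_gt_at_top[of 0]
    by eventually_elim (rule rescaled_walk_increments_char[symmetric, OF _ s])
qed

text \<open>Both sides are rewritten over the same grid with the same weights. For the Wiener process this is
valid only almost surely, since \<open>W q 0 = 0\<close> is.\<close>

lemma linear_combination_char_tendsto: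
  fixes N :: "'b measure" and W :: "nat \<Rightarrow> real \<Rightarrow> 'b \<Rightarrow> real" and a :: "real \<times> nat \<Rightarrow> real"
  assumes J: "finite J" "J \<subseteq> {0..} \<times> {q. prime q}"
    and W: "\<And>n (p :: nat \<Rightarrow> nat). n \<ge> 1 \<Longrightarrow> (\<forall>i\<in>{1..n}. prime (p i)) \<Longrightarrow> strict_mono_on {1..n} p \<Longrightarrow>
      wiener_process N n
        (\<lambda>i j. covariance M (\<lambda>\<omega>. real (multiplicity (p i) (\<xi> \<omega>)))
                             (\<lambda>\<omega>. real (multiplicity (p j) (\<xi> \<omega>))))
        (\<lambda>i. W (p i))"
  shows "((\<lambda>t. char (distr M borel (\<lambda>\<omega>. \<Sum>(u, q)\<in>J. a (u, q) * rescaled_walk t u q \<omega>)) 1)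
    \<longlongrightarrow> char (distr N borel (\<lambda>\<omega>. \<Sum>(u, q)\<in>J. a (u, q) * W q u \<omega>)) 1) at_top"
proof -
  obtain s :: "nat \<Rightarrow> real" and m n :: nat and p :: "nat \<Rightarrow> nat" where
    s0: "s 0 = 0" and s: "strict_mono_on {..m} s" and n: "1 \<le> n" and p: "strict_mono_on {1..n} p"
    and prime: "\<And>i. i \<in> {1..n} \<Longrightarrow> prime (p i)" and grid: "J \<subseteq> (s ` {..m}) \<times> (p ` {1..n})"
    using time_prime_grid[OF J] by blast
  define A where "A k i = (\<Sum>(u, q)\<in>J. if q = p i \<and> s k < u then a (u, q) else 0)" for k i
  let ?C = "\<lambda>i j. covariance M (\<lambda>\<omega>. real (multiplicity (p i) (\<xi> \<omega>))) (\<lambda>\<omega>. real (multiplicity (p j) (\<xi> \<omega>)))"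
  have wp: "wiener_process N n ?C (\<lambda>i. W (p i))"
    using n prime p by (intro W) auto
  interpret N: prob_space N using wp by (simp add: wiener_process_def)
  have inj: "inj_on p {1..n}" using p by (rule strict_mono_on_imp_inj_on)
  have step: "s k < s (Suc k)" if "k < m" for k
    using strict_mono_onD[OF s, of k "Suc k"] that by simp
  have byparts: "(\<Sum>(u, q)\<in>J. a (u, q) * G u q) =
      (\<Sum>k<m. \<Sum>i\<in>{1..n}. A k i * (G (s (Suc k)) (p i) - G (s k) (p i)))"
    if "\<And>i. i \<in> {1..n} \<Longrightarrow> G 0 (p i) = 0" for G :: "real \<Rightarrow> nat \<Rightarrow> real"
    unfolding A_def
    by (rule sum_by_parts_on_grid[OF J(1) s inj _ grid, of G "\<lambda>u q. a (u, q)"]) (use that s0 in auto)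
  have var: "expectation (\<lambda>\<omega>. (combination {1..n} p (A k) (\<xi> \<omega>))\<^sup>2) =
      (\<Sum>i\<in>{1..n}. \<Sum>j\<in>{1..n}. A k i * A k j * ?C i j)" for k
    by (rule combination_moments(3)) (use prime in auto)
  have Wm: "W q u \<in> borel_measurable N" if "(u, q) \<in> J" for u q
  proof -
    have "q \<in> p ` {1..n}" "0 \<le> u"
      using subsetD[OF grid that] subsetD[OF J(2) that] by auto
    moreover from this obtain i where "i \<in> {1..n}" "q = p i" by auto
    ultimately show ?thesis using wp by (simp add: wiener_process_def)
  qed
  have Wm': "W (p i) u \<in> borel_measurable N" if "i \<in> {1..n}" "0 \<le> u" for i u
    using wp that by (simp add: wiener_process_def)
  have sn: "0 \<le> s k" if "k \<le> m" for k
    using strict_mono_on_leD[OF s, of 0 k] that s0 by simp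
  have W0: "AE \<omega> in N. \<forall>i\<in>{1..n}. W (p i) 0 \<omega> = 0"
  proof -
    have "AE \<omega> in N. \<forall>i\<in>{1..n}. W (p i) 0 \<omega> = 0 \<and> continuous_on {0..} (\<lambda>u. W (p i) u \<omega>)"
      using wp unfolding wiener_process_def by blast
    then show ?thesis by eventually_elim blast
  qed
  have "distr N borel (\<lambda>\<omega>. \<Sum>(u, q)\<in>J. a (u, q) * W q u \<omega>) =
      distr N borel (\<lambda>\<omega>. \<Sum>k<m. \<Sum>i\<in>{1..n}. A k i * (W (p i) (s (Suc k)) \<omega> - W (p i) (s k) \<omega>))"
  proof (rule distr_cong_AE)
    show "AE \<omega> in N. (\<Sum>(u, q)\<in>J. a (u, q) * W q u \<omega>) =
        (\<Sum>k<m. \<Sum>i\<in>{1..n}. A k i * (W (p i) (s (Suc k)) \<omega> - W (p i) (s k) \<omega>))"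
      using W0
    proof eventually_elim
      case (elim \<omega>)
      show ?case by (rule byparts[of "\<lambda>u q. W q u \<omega>"]) (use elim in auto)
    qed
    show "(\<lambda>\<omega>. \<Sum>(u, q)\<in>J. a (u, q) * W q u \<omega>) \<in> borel_measurable N"
      unfolding case_prod_unfold
      by (intro borel_measurable_sum borel_measurable_times borel_measurable_const Wm) simp
    show "(\<lambda>\<omega>. \<Sum>k<m. \<Sum>i\<in>{1..n}. A k i * (W (p i) (s (Suc k)) \<omega> - W (p i) (s k) \<omega>)) \<in> borel_measurable N"
      by (intro borel_measurable_sum borel_measurable_times borel_measurable_const borel_measurable_diff Wm' sn) auto
  qed simp_all
  moreover have "char (distr N borel (\<lambda>\<omega>. \<Sum>k<m. \<Sum>i\<in>{1..n}. A k i * (W (p i) (s (Suc k)) \<omega> - W (p i) (s k) \<omega>))) 1 =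
      (\<Prod>k<m. of_real (exp (- ((s (Suc k) - s k) * (\<Sum>i\<in>{1..n}. \<Sum>j\<in>{1..n}. A k i * A k j * ?C i j) / 2))))"
  proof (rule wiener_increments_char[OF wp, where s = s and m = m and A = A])
    show "0 \<le> (\<Sum>i\<in>{1..n}. \<Sum>j\<in>{1..n}. A k i * A k j * ?C i j)" for k
      unfolding var[symmetric] by (intro integral_nonneg_AE) auto
  qed (use s0 step in auto)
  ultimately have limit: "char (distr N borel (\<lambda>\<omega>. \<Sum>(u, q)\<in>J. a (u, q) * W q u \<omega>)) 1 =
      (\<Prod>k<m. of_real (exp (- ((s (Suc k) - s k) * expectation (\<lambda>\<omega>. (combination {1..n} p (A k) (\<xi> \<omega>))\<^sup>2) / 2))))"
    by (simp only: var)
  have "(\<Sum>(u, q)\<in>J. a (u, q) * rescaled_walk t u q \<omega>) =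
      (\<Sum>k<m. \<Sum>i\<in>{1..n}. A k i * (rescaled_walk t (s (Suc k)) (p i) \<omega> - rescaled_walk t (s k) (p i) \<omega>))" for t \<omega>
    by (rule byparts) (simp add: rescaled_walk_def walk_def)
  then show ?thesis
    unfolding limit
    using rescaled_walk_increments_char_tendsto[of "{1..n}" p m s A] prime step s0 by (simp add: less_imp_le)
qed

end

section \<open>The limit theorem\<close>

theorem theorem5:
  fixes M :: "'a measure"
    and \<xi> \<eta> :: "'a \<Rightarrow> nat"
    and \<xi>s \<eta>s :: "nat \<Rightarrow> 'a \<Rightarrow> nat"
    and N :: "'b measure"
    and W :: "nat \<Rightarrow> real \<Rightarrow> 'b \<Rightarrow> real"
  assumes "prob_space M"
    and "\<xi> \<in> measurable M (count_space UNIV)"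
    and "\<eta> \<in> measurable M (count_space UNIV)"
    and "\<And>\<omega>. \<omega> \<in> space M \<Longrightarrow> \<xi> \<omega> \<ge> 1 \<and> \<eta> \<omega> \<ge> 1"
    and "\<And>k \<omega>. k \<ge> 1 \<Longrightarrow> \<omega> \<in> space M \<Longrightarrow> \<xi>s k \<omega> \<ge> 1 \<and> \<eta>s k \<omega> \<ge> 1"
    and "prob_space.indep_vars M (\<lambda>_. count_space UNIV) (\<lambda>k \<omega>. (\<xi>s k \<omega>, \<eta>s k \<omega>)) {1..}"
    and "\<And>k. k \<ge> 1 \<Longrightarrow>
      distr M (count_space UNIV) (\<lambda>\<omega>. (\<xi>s k \<omega>, \<eta>s k \<omega>)) =
      distr M (count_space UNIV) (\<lambda>\<omega>. (\<xi> \<omega>, \<eta> \<omega>))"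
    and "integrable M (\<lambda>\<omega>. (ln (real (\<xi> \<omega>)))\<^sup>2)"
    and "\<And>p. prime p \<Longrightarrow> integrable M (\<lambda>\<omega>. real (multiplicity p (\<eta> \<omega>)))"
    and "\<And>p. prime p \<Longrightarrow> measure M {\<omega> \<in> space M. p dvd \<xi> \<omega>} > 0"
    and "\<And>n (p :: nat \<Rightarrow> nat).
      n \<ge> 1 \<Longrightarrow> (\<forall>i\<in>{1..n}. prime (p i)) \<Longrightarrow> strict_mono_on {1..n} p \<Longrightarrow>
      wiener_process N n
        (\<lambda>i j. covariance M (\<lambda>\<omega>. real (multiplicity (p i) (\<xi> \<omega>)))
                             (\<lambda>\<omega>. real (multiplicity (p j) (\<xi> \<omega>))))
        (\<lambda>i. W (p i))"
  shows "conv_fdd ({0..} \<times> {p. prime p}) M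
    (\<lambda>t (u, p) \<omega>.
      (real (max_T \<xi>s \<eta>s p (nat \<lfloor>t * u\<rfloor>) \<omega>)
        - (\<integral>\<omega>'. real (multiplicity p (\<xi> \<omega>')) \<partial>M) * (t * u)) / sqrt t)
    N (\<lambda>(u, p). W p u)"
proof -
  interpret prime_factor_walk M \<xi> \<eta> \<xi>s \<eta>s
    by (rule prime_factor_walk.intro[OF assms(1) prime_factor_walk_axioms.intro]) (fact assms)+
  show ?thesis
    unfolding conv_fdd_def
  proof (intro allI impI)
    fix J :: "(real \<times> nat) set" assume "finite J \<and> J \<subseteq> {0..} \<times> {p. prime p}"
    then have J: "finite J" "J \<subseteq> {0..} \<times> {p. prime p}" by auto
    have W1: "wiener_process N 1
        (\<lambda>i j. covariance M (\<lambda>\<omega>. real (multiplicity q (\<xi> \<omega>))) (\<lambda>\<omega>. real (multiplicity q (\<xi> \<omega>))))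
        (\<lambda>i. W q)" if "prime q" for q
      using assms(11)[of 1 "\<lambda>_. q"] that by (simp add: strict_mono_on_def)
    show "conv_in_distr J M
      (\<lambda>t (u, p) \<omega>. (real (max_T \<xi>s \<eta>s p (nat \<lfloor>t * u\<rfloor>) \<omega>) - \<mu> p * (t * u)) / sqrt t)
      N (\<lambda>(u, p). W p u)"
    proof (rule cramer_wold_slutsky[where X' = "\<lambda>t (u, p). rescaled_walk t u p"])
      show "prob_space M" by (rule assms(1))
      show "prob_space N" using W1[OF two_is_prime_nat] by (simp add: wiener_process_def)
      show "finite J" by (rule J(1))
    next
      fix t j assume "j \<in> J"
      then obtain u q where j: "j = (u, q)" "0 \<le> u" "prime q" using J(2) by auto
      show "(case j of (u, p) \<Rightarrow> \<lambda>\<omega>. (real (max_T \<xi>s \<eta>s p (nat \<lfloor>t * u\<rfloor>) \<omega>) - \<mu> p * (t * u)) / sqrt t)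
          \<in> borel_measurable M"
        unfolding j(1) prod.case
        by (intro borel_measurable_divide borel_measurable_diff max_T_rv[OF j(3)] borel_measurable_const)
      show "(case j of (u, p) \<Rightarrow> rescaled_walk t u p) \<in> borel_measurable M"
        unfolding j(1) prod.case by (rule rescaled_walk_rv)
      show "(case j of (u, p) \<Rightarrow> W p u) \<in> borel_measurable N"
        using W1[OF j(3)] j(2) unfolding j(1) by (simp add: wiener_process_def)
    next
      fix j and e :: real assume "j \<in> J" and e: "0 < e"
      then obtain u q where j: "j = (u, q)" "0 \<le> u" "prime q" using J(2) by auto
      show "\<exists>K. \<forall>\<^sub>F t in at_top. prob {\<omega> \<in> space M. K < \<bar>(case j of (u, p) \<Rightarrow> rescaled_walk t u p) \<omega>\<bar>} \<le> e"
        unfolding j(1) prod.case by (rule rescaled_walk_tight[OF j(3,2) e])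
      show "((\<lambda>t. prob {\<omega> \<in> space M. e <
          \<bar>(case j of (u, p) \<Rightarrow> \<lambda>\<omega>. (real (max_T \<xi>s \<eta>s p (nat \<lfloor>t * u\<rfloor>) \<omega>) - \<mu> p * (t * u)) / sqrt t) \<omega> -
           (case j of (u, p) \<Rightarrow> rescaled_walk t u p) \<omega>\<bar>}) \<longlongrightarrow> 0) at_top"
        unfolding j(1) prod.case by (rule max_T_close_rescaled_walk[OF j(3,2) e])
    next
      fix a :: "real \<times> nat \<Rightarrow> real"
      have curried: "(\<Sum>j\<in>J. a j * (case j of (u, p) \<Rightarrow> f u p) \<omega>) = (\<Sum>(u, q)\<in>J. a (u, q) * f u q \<omega>)"
        for f :: "real \<Rightarrow> nat \<Rightarrow> 'c \<Rightarrow> real" and \<omega>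
        by (intro sum.cong refl) (simp add: case_prod_unfold)
      show "((\<lambda>t. char (distr M borel (\<lambda>\<omega>. \<Sum>j\<in>J. a j * (case j of (u, p) \<Rightarrow> rescaled_walk t u p) \<omega>)) 1)
          \<longlongrightarrow> char (distr N borel (\<lambda>\<omega>. \<Sum>j\<in>J. a j * (case j of (u, p) \<Rightarrow> W p u) \<omega>)) 1) at_top"
        unfolding curried by (rule linear_combination_char_tendsto[OF J assms(11)])
    qed
  qed
qed

end
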